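(* Let $\Sigma^n \subset \mathbf{R}^{n+1}$ be a complete properly embedded shrinker (without boundary) that lies on one side of a generalized cylinder $\mathbf{S}^k_{\sqrt{2k}} \times \mathbf{R}^{n-k}$ for some $k \in \{0, 1, \dots, n\}$. Then $\Sigma = \mathbf{S}^k_{\sqrt{2k}} \times \mathbf{R}^{n-k}$.
   Context: A shrinker is a (smooth, nonempty) $n$-dimensional submanifold $\Sigma^n \subset \mathbf{R}^{N}$ satisfying the shrinker equation $\mathbf{H} = \frac{1}{2} x^{\perp}$, where $x$ is the position vector, $x^\perp$ is its component normal to $\Sigma$, and $\mathbf{H}$ is the mean curvature vector with the sign convention $\mathbf{H} = -\sum_i A(f_i,f_i)$ ($A$ the vector-valued second fundamental form $A(X,Y) = (D_X Y)^\perp$, $D$ the Euclidean derivative, $f_i$ an orthonormal tangent frame). Equivalently, $\Sigma$ is a critical point of the Gaussian area $F(\Sigma) = (4\pi)^{-n/2}\int_\Sigma e^{-|x|^2/4}$. Generalized cylinders: $\mathbf{S}^k_{\sqrt{2k}} \times \mathbf{R}^{n-k} \subset \mathbf{R}^{n+1}$, where the $k$-sphere is centered at $0$ with radius $\sqrt{2k}$ in a $(k+1)$-dimensional linear subspace and $\mathbf{R}^{n-k}$ is the orthogonal complementary linear subspace (containing $0$). All rotations about the origin are allowed. The case $k=0$ means a hyperplane through the origin, and $k=n$ means the $n$-sphere of radius $\sqrt{2n}$ centered at the origin. The complement of such a cylinder in $\mathbf{R}^{n+1}$ has two components; $\Sigma$ lies on one side of the cylinder if $\Sigma$ intersects at most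 one of these two components (touching the cylinder itself is allowed). *)

theory Defs
  imports "HOL-Analysis.Analysis"
begin

(* Smooth means C^infinity.  The predicates below are used on open sets only. *)

primrec Ck_on :: "nat \<Rightarrow> ('a::real_normed_vector \<Rightarrow> 'b::real_normed_vector) \<Rightarrow> 'a set \<Rightarrow> bool" where
  "Ck_on 0 f U \<longleftrightarrow> continuous_on U f"
| "Ck_on (Suc k) f U \<longleftrightarrow>
     (\<forall>x\<in>U. f differentiable (at x)) \<and> (\<forall>v. Ck_on k (\<lambda>x. frechet_derivative f (at x) v) U)"

definition smooth_on :: "('a::real_normed_vector \<Rightarrow> 'b::real_normed_vector) \<Rightarrow> 'a set \<Rightarrow> bool" where
  "smooth_on f U \<longleftrightarrow> (\<forall>k. Ck_on k f U)"

(* Embedded n-dimensional submanifold without boundary: around each of its points there is a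
   diffeomorphism of open subsets of the ambient space that flattens S to an n-dimensional
   linear subspace. *)

definition submanifold :: "nat \<Rightarrow> 'a::euclidean_space set \<Rightarrow> bool" where
  "submanifold n S \<longleftrightarrow>
     (\<forall>p\<in>S. \<exists>U V \<phi> \<psi> L. open U \<and> p \<in> U \<and> open (V :: 'a set) \<and>
        homeomorphism U V \<phi> \<psi> \<and> smooth_on \<phi> U \<and> smooth_on \<psi> V \<and>
        subspace L \<and> dim L = n \<and> \<phi> ` (S \<inter> U) = L \<inter> V)"

definition tangent_space :: "'a::euclidean_space set \<Rightarrow> 'a \<Rightarrow> 'a set" where
  "tangent_space S p =
     {v. \<exists>e>0. \<exists>\<gamma>. smooth_on \<gamma> {-e<..<e::real} \<and> \<gamma> ` {-e<..<e} \<subseteq> S \<and>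
           \<gamma> 0 = p \<and> (\<gamma> has_vector_derivative v) (at 0)}"

definition normal_part :: "'a::euclidean_space set \<Rightarrow> 'a \<Rightarrow> 'a \<Rightarrow> 'a" where
  "normal_part S p x =
     (THE y. y \<in> orthogonal_comp (tangent_space S p) \<and> x - y \<in> tangent_space S p)"

(* A(v,w) = (D_v Y)^perp, where Y is any smooth vector field near p that is tangent to S along S
   and has Y(p) = w; on a submanifold, for tangent v and w, the value does not depend on Y. *)

definition second_fundamental_form :: "'a::euclidean_space set \<Rightarrow> 'a \<Rightarrow> 'a \<Rightarrow> 'a \<Rightarrow> 'a" where
  "second_fundamental_form S p v w =
     (THE a. \<exists>U Y. open U \<and> p \<in> U \<and> smooth_on Y U \<and>
        (\<forall>q\<in>S \<inter> U. Y q \<in> tangent_space S q) \<and> Y p = w \<and>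
        a = normal_part S p (frechet_derivative Y (at p) v))"

definition orthonormal_basis_of :: "'a::euclidean_space set \<Rightarrow> 'a set \<Rightarrow> bool" where
  "orthonormal_basis_of T B \<longleftrightarrow>
     B \<subseteq> T \<and> pairwise orthogonal B \<and> (\<forall>b\<in>B. norm b = 1) \<and> span B = T"

(* Trace of A with a minus sign; it does not depend on the orthonormal basis chosen. *)

definition mean_curvature :: "'a::euclidean_space set \<Rightarrow> 'a \<Rightarrow> 'a" where
  "mean_curvature S p =
     - (\<Sum>f\<in>(SOME B. orthonormal_basis_of (tangent_space S p) B). second_fundamental_form S p f f)"

definition shrinker :: "nat \<Rightarrow> 'a::euclidean_space set \<Rightarrow> bool" where
  "shrinker n S \<longleftrightarrow> submanifold n S \<and> S \<noteq> {} \<and>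
     (\<forall>x\<in>S. mean_curvature S x = (1 / 2) *\<^sub>R normal_part S x x)"

definition proper_inclusion :: "'a::euclidean_space set \<Rightarrow> bool" where
  "proper_inclusion S \<longleftrightarrow> (\<forall>K. compact K \<longrightarrow> compact (S \<inter> K))"

(* Completeness for the induced Riemannian distance.  The length is a Lebesgue integral in
   [0,\<infinity>]: a valid_path may have infinite length, where the real-valued integral would be 0.
   Points in different components have distance \<infinity>, the infimum of the empty set. *)

definition curve_length :: "(real \<Rightarrow> 'a::euclidean_space) \<Rightarrow> ennreal" where
  "curve_length g = (\<integral>\<^sup>+t\<in>{0..1}. ennreal (norm (vector_derivative g (at t))) \<partial>lborel)"

definition intrinsic_dist :: "'a::euclidean_space set \<Rightarrow> 'a \<Rightarrow> 'a \<Rightarrow> ennreal" where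
  "intrinsic_dist S p q =
     Inf {curve_length g | g. valid_path g \<and> path_image g \<subseteq> S \<and> pathstart g = p \<and> pathfinish g = q}"

definition intrinsically_complete :: "'a::euclidean_space set \<Rightarrow> bool" where
  "intrinsically_complete S \<longleftrightarrow>
     (\<forall>x :: nat \<Rightarrow> 'a. range x \<subseteq> S \<longrightarrow>
        (\<forall>e>0. \<exists>N. \<forall>i\<ge>N. \<forall>j\<ge>N. intrinsic_dist S (x i) (x j) < ennreal e) \<longrightarrow>
        (\<exists>l\<in>S. (\<lambda>i. intrinsic_dist S (x i) l) \<longlonglongrightarrow> 0))"

(* For dim W = k + 1 this is the cylinder with spherical factor in W and Euclidean factor the
   orthogonal complement of W; rotations are accounted for by the choice of W.  For k = 0 the
   radius is 0 and the set is the hyperplane orthogonal to W. *)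

definition generalized_cylinder :: "nat \<Rightarrow> 'a::euclidean_space set \<Rightarrow> 'a set" where
  "generalized_cylinder k W =
     {u + v | u v. u \<in> W \<and> norm u = sqrt (2 * real k) \<and> v \<in> orthogonal_comp W}"

definition on_one_side :: "'a::euclidean_space set \<Rightarrow> 'a set \<Rightarrow> bool" where
  "on_one_side S C \<longleftrightarrow>
     (\<forall>U\<in>components (- C). \<forall>V\<in>components (- C). S \<inter> U \<noteq> {} \<longrightarrow> S \<inter> V \<noteq> {} \<longrightarrow> U = V)"

end

theory Submission
  imports Defs
begin

text \<open>
  On a shrinker the drift Laplacian of (the restriction of) a function \<open>F\<close> is
  \<open>\<L> F = tr D\<^sup>2F - D\<^sup>2F(\<nu>,\<nu>) - DF(x) / 2\<close>, with \<open>\<nu>\<close> the unit normal and \<open>DF(x)\<close> the derivative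
  in the direction of the position vector \<open>x\<close>.  Let \<open>u\<close> be the orthogonal projection of \<open>x\<close> to
  \<open>W\<close>.  Inside the cylinder \<open>v = |u|\<^sup>2\<close>, outside it \<open>v = -|u|\<close>, and for \<open>k = 0\<close> a linear function
  \<open>v\<close>, is bounded above, satisfies \<open>\<L> v \<ge> \<theta> \<ge> 0\<close>, and \<open>\<theta>\<close> vanishes only on the cylinder.  As
  \<open>\<L> |x|\<^sup>2 = 2 n - |x|\<^sup>2\<close> and \<open>|x|\<^sup>2\<close> is proper, maxima of \<open>v - \<epsilon> |x|\<^sup>2\<close> stay bounded as
  \<open>\<epsilon> \<rightarrow> 0\<close>, so every nonempty closed and relatively open part of the shrinker touches the
  cylinder.  Hopf's strong maximum principle, run with barriers \<open>exp (-\<alpha> |x - y|\<^sup>2)\<close> centred near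
  points of the cylinder, shows that the touching set is open in the cylinder, which therefore lies
  in the shrinker.  By invariance of domain it is relatively open there, and the rest of the
  shrinker, which does not touch it, must be empty.
\<close>

subsection \<open>Smooth maps\<close>


lemma Ck_on_cong:
  assumes "open U" "\<And>x. x \<in> U \<Longrightarrow> f x = g x" "Ck_on k f U"
  shows "Ck_on k g U"
  using assms(2,3)
proof (induction k arbitrary: f g)
  case 0
  then show ?case by (simp cong: continuous_on_cong)
next
  case (Suc k)
  have d: "(g has_derivative frechet_derivative f (at x)) (at x)" if "x \<in> U" for x
  proof (rule has_derivative_transform_within_open[OF _ assms(1) that])
    show "(f has_derivative frechet_derivative f (at x)) (at x)"
      using Suc.prems(2) that frechet_derivative_works by auto
  qed (use Suc.prems(1) in auto)
  then have eq: "frechet_derivative f (at x) = frechet_derivative g (at x)" if "x \<in> U" for x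
    using frechet_derivative_at that by blast
  have "Ck_on k (\<lambda>x. frechet_derivative g (at x) v) U" for v
    by (rule Suc.IH[of "\<lambda>x. frechet_derivative f (at x) v"]) (use eq Suc.prems in auto)
  then show ?case
    using d differentiable_def by (auto; blast)
qed

lemma Ck_on_SucD: "Ck_on (Suc k) f U \<Longrightarrow> Ck_on k f U"
proof (induction k arbitrary: f)
  case 0
  then show ?case
    by (auto intro!: continuous_at_imp_continuous_on differentiable_imp_continuous_within)
next
  case (Suc k)
  then show ?case by simp
qed

lemma Ck_on_const: "Ck_on k (\<lambda>x. c) U"
  by (induction k arbitrary: c) auto

lemma Ck_on_bounded_linear:
  assumes "open U" "bounded_linear F" "Ck_on k f U"
  shows "Ck_on k (\<lambda>x. F (f x)) U"
  using assms(3)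
proof (induction k arbitrary: f)
  case 0
  then show ?case using assms(2) by (simp add: bounded_linear.continuous_on)
next
  case (Suc k)
  have d: "((\<lambda>x. F (f x)) has_derivative (\<lambda>v. F (frechet_derivative f (at x) v))) (at x)"
    if "x \<in> U" for x
    using Suc.prems that by (intro bounded_linear.has_derivative[OF assms(2)]) (simp add: frechet_derivative_works[symmetric])
  have "Ck_on k (\<lambda>x. frechet_derivative (\<lambda>x. F (f x)) (at x) v) U" for v
    by (rule Ck_on_cong[OF assms(1), of "\<lambda>x. F (frechet_derivative f (at x) v)"])
       (use d Suc in \<open>auto simp: frechet_derivative_at[OF d, symmetric]\<close>)
  then show ?case using d differentiable_def by (auto; blast)
qed

lemma Ck_on_add:
  assumes "open U" "Ck_on k f U" "Ck_on k g U"
  shows "Ck_on k (\<lambda>x. f x + g x) U"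
  using assms(2,3)
proof (induction k arbitrary: f g)
  case 0
  then show ?case by (simp add: continuous_on_add)
next
  case (Suc k)
  have d: "((\<lambda>x. f x + g x) has_derivative
      (\<lambda>v. frechet_derivative f (at x) v + frechet_derivative g (at x) v)) (at x)"
    if "x \<in> U" for x
    using Suc.prems that by (intro has_derivative_add) (simp_all add: frechet_derivative_works[symmetric])
  have "Ck_on k (\<lambda>x. frechet_derivative (\<lambda>x. f x + g x) (at x) v) U" for v
    by (rule Ck_on_cong[OF assms(1),
          of "\<lambda>x. frechet_derivative f (at x) v + frechet_derivative g (at x) v"])
       (use d Suc in \<open>auto simp: frechet_derivative_at[OF d, symmetric]\<close>)
  then show ?case using d differentiable_def by (auto; blast)
qed

lemma Ck_on_sum:
  assumes "open U" "\<And>i. i \<in> I \<Longrightarrow> Ck_on k (f i) U"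
  shows "Ck_on k (\<lambda>x. \<Sum>i\<in>I. f i x) U"
  using assms(2)
  by (induction I rule: infinite_finite_induct) (auto intro: Ck_on_const Ck_on_add assms(1))

lemma Ck_on_scaleR:
  fixes f :: "'a::real_normed_vector \<Rightarrow> real"
  assumes "open U" "Ck_on k f U" "Ck_on k g U"
  shows "Ck_on k (\<lambda>x. f x *\<^sub>R g x) U"
  using assms(2,3)
proof (induction k arbitrary: f g)
  case 0
  then show ?case by (simp add: continuous_on_scaleR)
next
  case (Suc k)
  note low = Suc.prems[THEN Ck_on_SucD]
  have d: "((\<lambda>x. f x *\<^sub>R g x) has_derivative
      (\<lambda>v. f x *\<^sub>R frechet_derivative g (at x) v + frechet_derivative f (at x) v *\<^sub>R g x)) (at x)"
    if "x \<in> U" for x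
    using Suc.prems that by (intro has_derivative_scaleR) (simp_all add: frechet_derivative_works[symmetric])
  have "Ck_on k (\<lambda>x. frechet_derivative (\<lambda>x. f x *\<^sub>R g x) (at x) v) U" for v
    by (rule Ck_on_cong[OF assms(1),
          of "\<lambda>x. f x *\<^sub>R frechet_derivative g (at x) v + frechet_derivative f (at x) v *\<^sub>R g x"])
       (use d Suc in \<open>auto simp: frechet_derivative_at[OF d, symmetric]
         intro!: Ck_on_add assms(1) Suc.IH low\<close>)
  then show ?case using d differentiable_def by (auto; blast)
qed

lemma linear_euclidean_expansion:
  fixes F :: "'a::euclidean_space \<Rightarrow> 'b::real_vector"
  assumes "linear F"
  shows "F v = (\<Sum>i\<in>Basis. (v \<bullet> i) *\<^sub>R F i)"
  by (subst euclidean_representation[of v, symmetric])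
     (simp only: linear_sum[OF assms] linear_cmul[OF assms])

text \<open>\<open>Ck_on\<close> speaks of derivatives in fixed directions only, while the chain
  rule applies the derivative of \<open>f\<close> to the moving vector
  \<open>frechet_derivative g (at x) v\<close>. Expanding that vector in \<open>Basis\<close> leaves
  a finite sum of products, in which \<open>f\<close> is differentiated along fixed
  \<open>i\<close>.\<close>

lemma Ck_on_compose:
  fixes g :: "'a::real_normed_vector \<Rightarrow> 'b::euclidean_space" and f :: "'b \<Rightarrow> 'c::real_normed_vector"
  assumes "open U" "g ` U \<subseteq> V" "Ck_on k g U" "Ck_on k f V"
  shows "Ck_on k (\<lambda>x. f (g x)) U"
  using assms(3,4)
proof (induction k arbitrary: f)
  case 0
  then show ?case
    using assms(2) continuous_on_compose2 by auto
next
  case (Suc k)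
  have d: "((\<lambda>x. f (g x)) has_derivative
      (\<lambda>v. frechet_derivative f (at (g x)) (frechet_derivative g (at x) v))) (at x)"
    if "x \<in> U" for x
  proof -
    have "(g has_derivative frechet_derivative g (at x)) (at x)"
      using Suc.prems(1) that frechet_derivative_works by auto
    moreover have "(f has_derivative frechet_derivative f (at (g x))) (at (g x))"
      using Suc.prems(2) that assms(2) frechet_derivative_works by auto
    ultimately show ?thesis by (rule has_derivative_compose)
  qed
  have "Ck_on k (\<lambda>x. \<Sum>i\<in>Basis. (frechet_derivative g (at x) v \<bullet> i) *\<^sub>R
      frechet_derivative f (at (g x)) i) U" for v
  proof (intro Ck_on_sum Ck_on_scaleR assms(1))
    fix i :: 'b
    show "Ck_on k (\<lambda>x. frechet_derivative g (at x) v \<bullet> i) U"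
      using Suc.prems(1) Ck_on_bounded_linear[OF assms(1) bounded_linear_inner_left[of i],
          of k "\<lambda>x. frechet_derivative g (at x) v"] by auto
    show "Ck_on k (\<lambda>x. frechet_derivative f (at (g x)) i) U"
      using Suc.prems(2) Suc.IH[OF Ck_on_SucD[OF Suc.prems(1)], of "\<lambda>y. frechet_derivative f (at y) i"]
      by simp
  qed
  moreover have "(\<Sum>i\<in>Basis. (frechet_derivative g (at x) v \<bullet> i) *\<^sub>R frechet_derivative f (at (g x)) i)
      = frechet_derivative (\<lambda>x. f (g x)) (at x) v" if "x \<in> U" for x v
  proof -
    have "f differentiable at (g x)" using Suc.prems assms(2) that by auto
    then show ?thesis
      unfolding frechet_derivative_at[OF d[OF that], symmetric]
      by (rule linear_euclidean_expansion[OF linear_frechet_derivative, symmetric])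
  qed
  ultimately have "Ck_on k (\<lambda>x. frechet_derivative (\<lambda>x. f (g x)) (at x) v) U" for v
    by (rule Ck_on_cong[OF assms(1), rotated])
  then show ?case using d differentiable_def by (auto; blast)
qed

lemma smooth_on_affine:
  fixes a c :: "'a::real_normed_vector"
  assumes "open U"
  shows "smooth_on (\<lambda>t::real. a + t *\<^sub>R c) U"
  unfolding smooth_on_def
proof
  fix k
  have d: "((\<lambda>t::real. a + t *\<^sub>R c) has_derivative (\<lambda>v. v *\<^sub>R c)) (at t)" for t
    by (auto intro!: derivative_eq_intros)
  show "Ck_on k (\<lambda>t::real. a + t *\<^sub>R c) U"
  proof (cases k)
    case 0
    then show ?thesis by (auto intro!: continuous_intros)
  next
    case (Suc l)
    then show ?thesis
      using d differentiable_def by (auto simp: frechet_derivative_at[OF d, symmetric] Ck_on_const; blast)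
  qed
qed

lemma smooth_on_compose:
  fixes g :: "'a::real_normed_vector \<Rightarrow> 'b::euclidean_space"
  shows "open U \<Longrightarrow> g ` U \<subseteq> V \<Longrightarrow> smooth_on g U \<Longrightarrow> smooth_on f V \<Longrightarrow> smooth_on (\<lambda>x. f (g x)) U"
  unfolding smooth_on_def using Ck_on_compose by blast

lemma smooth_onD:
  assumes "smooth_on f U" "x \<in> U"
  shows "f differentiable at x"
    and "(\<lambda>x. frechet_derivative f (at x) v) differentiable at x"
    and "smooth_on (\<lambda>x. frechet_derivative f (at x) v) U"
proof -
  have *: "Ck_on (Suc (Suc k)) f U" for k
    using assms(1) unfolding smooth_on_def by blast
  show "f differentiable at x" "(\<lambda>x. frechet_derivative f (at x) v) differentiable at x"
    using *[of 0] assms(2) by auto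
  show "smooth_on (\<lambda>x. frechet_derivative f (at x) v) U"
    unfolding smooth_on_def using * Ck_on_SucD by (metis Ck_on.simps(2))
qed


subsection \<open>Geometry of a hypersurface in a slice chart\<close>

lemma subspace_orthogonal_compI:
  fixes L :: "'a::euclidean_space set"
  assumes "subspace L" "\<And>l. l \<in> orthogonal_comp L \<Longrightarrow> l \<bullet> x = 0"
  shows "x \<in> L"
  using assms orthogonal_comp_self[OF assms(1)] by (auto simp: orthogonal_comp_def orthogonal_def)

text \<open>A vector normal to \<open>L\<close> pairs with \<open>f\<close> to a function that
  vanishes near \<open>t\<close>, so it annihilates \<open>d\<close>; hence \<open>d\<close> lies in
  the double orthogonal complement of \<open>L\<close>.\<close>

lemma has_vector_derivative_in_subspace:
  fixes f :: "real \<Rightarrow> 'a::euclidean_space"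
  assumes "subspace L" "(f has_vector_derivative d) (at t)" "\<forall>\<^sub>F s in nhds t. f s \<in> L"
  shows "d \<in> L"
proof (rule subspace_orthogonal_compI[OF assms(1)])
  fix l assume "l \<in> orthogonal_comp L"
  then have l: "l \<bullet> x = 0" if "x \<in> L" for x
    using that by (auto simp: orthogonal_comp_def orthogonal_def inner_commute)
  obtain T where T: "open T" "t \<in> T" "\<And>s. s \<in> T \<Longrightarrow> f s \<in> L"
    using assms(3) unfolding eventually_nhds by blast
  have "((\<lambda>s. l \<bullet> f s) has_vector_derivative l \<bullet> d) (at t)"
    by (rule bounded_linear.has_vector_derivative[OF bounded_linear_inner_right assms(2)])
  moreover have "((\<lambda>s. l \<bullet> f s) has_vector_derivative 0) (at t)"
    by (rule has_vector_derivative_transform_within_open[of "\<lambda>s. 0", OF _ T(1,2)])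
       (use l T(3) in auto)
  ultimately show "l \<bullet> d = 0"
    by (rule vector_derivative_unique_at)
qed

lemma has_vector_derivative_compose_derivative:
  assumes "(f has_vector_derivative f') (at t)" "(g has_derivative g') (at (f t))"
  shows "((\<lambda>s. g (f s)) has_vector_derivative g' f') (at t)"
  using vector_derivative_diff_chain_within[OF assms(1) has_derivative_at_withinI[OF assms(2)]]
  by (simp add: o_def)

lemma normal_part_eqI:
  fixes S :: "'a::euclidean_space set"
  assumes "subspace (tangent_space S p)"
    and "y \<in> orthogonal_comp (tangent_space S p)" "x - y \<in> tangent_space S p"
  shows "normal_part S p x = y"
  unfolding normal_part_def
proof (rule the_equality)
  fix y' assume y': "y' \<in> orthogonal_comp (tangent_space S p) \<and> x - y' \<in> tangent_space S p"
  have "y' - y \<in> orthogonal_comp (tangent_space S p)"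
    using y' assms(2) by (simp add: subspace_diff subspace_orthogonal_comp)
  moreover have "y' - y \<in> tangent_space S p"
    using subspace_diff[OF assms(1,3) conjunct2[OF y']] by simp
  ultimately show "y' = y"
    by (auto simp: orthogonal_comp_def orthogonal_def)
qed (use assms in auto)

lemma normal_part_props:
  fixes S :: "'a::euclidean_space set"
  assumes "subspace (tangent_space S p)"
  shows "normal_part S p x \<in> orthogonal_comp (tangent_space S p)"
    and "x - normal_part S p x \<in> tangent_space S p"
proof -
  obtain y z where "y \<in> span (tangent_space S p)"
    "\<And>w. w \<in> span (tangent_space S p) \<Longrightarrow> orthogonal z w" "x = y + z"
    using orthogonal_subspace_decomp_exists by blast
  then have *: "z \<in> orthogonal_comp (tangent_space S p)" "x - z \<in> tangent_space S p"
    using span_eq_iff[THEN iffD2, OF assms]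
    by (auto simp: orthogonal_comp_def orthogonal_commute)
  with normal_part_eqI[OF assms *]
  show "normal_part S p x \<in> orthogonal_comp (tangent_space S p)"
    "x - normal_part S p x \<in> tangent_space S p" by auto
qed

locale slice_chart =
  fixes S U V L :: "'a::euclidean_space set" and \<phi> \<psi> :: "'a \<Rightarrow> 'a"
  assumes open_U: "open U" and open_V: "open V"
    and homeo: "homeomorphism U V \<phi> \<psi>"
    and smooth_chart: "smooth_on \<phi> U" and smooth_inv: "smooth_on \<psi> V"
    and subspace_L: "subspace L" and slice: "\<phi> ` (S \<inter> U) = L \<inter> V"
begin

abbreviation D where "D q \<equiv> frechet_derivative \<phi> (at q)"
abbreviation E where "E x \<equiv> frechet_derivative \<psi> (at x)"

lemma chart_in: "q \<in> U \<Longrightarrow> \<phi> q \<in> V"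
  and inv_chart: "q \<in> U \<Longrightarrow> \<psi> (\<phi> q) = q"
  and inv_in: "x \<in> V \<Longrightarrow> \<psi> x \<in> U"
  and chart_inv: "x \<in> V \<Longrightarrow> \<phi> (\<psi> x) = x"
  using homeo unfolding homeomorphism_def by auto

lemma inv_slice: "x \<in> L \<Longrightarrow> x \<in> V \<Longrightarrow> \<psi> x \<in> S"
  using slice inv_chart by force

lemma chart_slice: "q \<in> S \<Longrightarrow> q \<in> U \<Longrightarrow> \<phi> q \<in> L"
  using slice by blast

section \<open>Derivatives of a slice chart, curves in the hypersurface and tangent spaces\<close>

lemma D_deriv: "q \<in> U \<Longrightarrow> (\<phi> has_derivative D q) (at q)"
  using smooth_onD(1)[OF smooth_chart] frechet_derivative_works by blast

lemma E_deriv: "x \<in> V \<Longrightarrow> (\<psi> has_derivative E x) (at x)"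
  using smooth_onD(1)[OF smooth_inv] frechet_derivative_works by blast

lemma linear_D: "q \<in> U \<Longrightarrow> linear (D q)"
  using D_deriv has_derivative_linear by blast

lemma E_D: assumes "q \<in> U" shows "E (\<phi> q) (D q v) = v"
proof -
  have "((\<lambda>x. \<psi> (\<phi> x)) has_derivative (\<lambda>v. E (\<phi> q) (D q v))) (at q)"
    using D_deriv[OF assms] E_deriv[OF chart_in[OF assms]] by (rule has_derivative_compose)
  then have "((\<lambda>x. x) has_derivative (\<lambda>v. E (\<phi> q) (D q v))) (at q)"
    by (rule has_derivative_transform_within_open[OF _ open_U assms]) (rule inv_chart)
  from has_derivative_unique[OF this has_derivative_ident] show ?thesis
    by (rule fun_cong)
qed

lemma D_E: assumes "q \<in> U" shows "D q (E (\<phi> q) v) = v"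
proof -
  have *: "\<phi> q \<in> V" using chart_in assms by blast
  have "((\<lambda>x. \<phi> (\<psi> x)) has_derivative (\<lambda>v. D q (E (\<phi> q) v))) (at (\<phi> q))"
    using has_derivative_compose[OF E_deriv[OF *], of \<phi> "D q"] D_deriv[OF assms] inv_chart[OF assms]
    by simp
  then have "((\<lambda>x. x) has_derivative (\<lambda>v. D q (E (\<phi> q) v))) (at (\<phi> q))"
    by (rule has_derivative_transform_within_open[OF _ open_V *]) (rule chart_inv)
  from has_derivative_unique[OF this has_derivative_ident] show ?thesis
    by (rule fun_cong)
qed

text \<open>The curve is the image under \<open>\<psi>\<close> of a straight segment in
  \<open>L\<close> with direction \<open>D q v\<close>. Its velocity is constant in the chart, which
  determines the acceleration \<open>a\<close> in \<open>acceleration\<close> below.\<close>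

lemma straight_curve:
  assumes "q \<in> S" "q \<in> U" "D q v \<in> L"
  obtains e \<gamma> \<gamma>' a where "e > 0" "smooth_on \<gamma> {-e<..<e}" "\<gamma> ` {-e<..<e} \<subseteq> S \<inter> U" "\<gamma> 0 = q"
    "\<And>t. t \<in> {-e<..<e} \<Longrightarrow> (\<gamma> has_vector_derivative \<gamma>' t) (at t)" "\<gamma>' 0 = v"
    "(\<gamma>' has_vector_derivative a) (at 0)"
    "\<And>t. t \<in> {-e<..<e} \<Longrightarrow> D (\<gamma> t) (\<gamma>' t) = D q v"
proof -
  define l where "l t = \<phi> q + t *\<^sub>R D q v" for t
  have cl: "continuous_on UNIV l" unfolding l_def by (intro continuous_intros)
  have "open (l -` V)" "0 \<in> l -` V"
    using open_vimage[OF open_V cl] chart_in[OF assms(2)] by (auto simp: l_def)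
  then obtain e where e: "e > 0" "ball 0 e \<subseteq> l -` V" by (meson openE)
  have ball: "ball 0 e = {-e<..<e}" by (auto simp: dist_real_def)
  have lV: "l t \<in> V" if "t \<in> {-e<..<e}" for t using e(2) that unfolding ball by auto
  have lL: "l t \<in> L" for t
    unfolding l_def using assms chart_slice by (intro subspace_add subspace_scale subspace_L)
  have dl: "(l has_vector_derivative D q v) (at t)" for t
    unfolding l_def by (auto intro!: derivative_eq_intros)
  define \<gamma> where "\<gamma> t = \<psi> (l t)" for t
  define \<gamma>' where "\<gamma>' t = E (l t) (D q v)" for t
  have "(\<lambda>x. E x (D q v)) differentiable at (l 0)"
    using smooth_onD(2)[OF smooth_inv] lV e(1) by simp
  then obtain A where A: "((\<lambda>x. E x (D q v)) has_derivative A) (at (l 0))"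
    unfolding differentiable_def by blast
  show ?thesis
  proof
    show "smooth_on \<gamma> {-e<..<e}"
      unfolding \<gamma>_def using lV
      by (intro smooth_on_compose[OF _ _ _ smooth_inv])
         (auto simp: l_def intro!: smooth_on_affine)
    show "\<gamma> ` {-e<..<e} \<subseteq> S \<inter> U"
      unfolding \<gamma>_def using lV lL inv_slice inv_in by auto
    show "\<gamma> 0 = q" "\<gamma>' 0 = v"
      unfolding \<gamma>_def \<gamma>'_def l_def by (simp_all add: inv_chart E_D assms)
    show "(\<gamma> has_vector_derivative \<gamma>' t) (at t)" if "t \<in> {-e<..<e}" for t
      unfolding \<gamma>_def \<gamma>'_def
      by (rule has_vector_derivative_compose_derivative[OF dl E_deriv[OF lV[OF that]]])
    show "(\<gamma>' has_vector_derivative A (D q v)) (at 0)"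
      unfolding \<gamma>'_def by (rule has_vector_derivative_compose_derivative[OF dl A])
    show "D (\<gamma> t) (\<gamma>' t) = D q v" if "t \<in> {-e<..<e}" for t
      using D_E[OF inv_in[OF lV[OF that]]] chart_inv[OF lV[OF that]]
      unfolding \<gamma>_def \<gamma>'_def by simp
  qed (rule e(1))
qed

lemma curve_with_velocity:
  assumes "q \<in> S" "q \<in> U" "D q v \<in> L"
  obtains e \<gamma> where "e > 0" "smooth_on \<gamma> {-e<..<e}" "\<gamma> ` {-e<..<e} \<subseteq> S \<inter> U" "\<gamma> 0 = q"
    "(\<gamma> has_vector_derivative v) (at (0::real))"
proof (rule straight_curve[OF assms])
  fix e \<gamma> \<gamma>' a
  assume g: "e > 0" "smooth_on \<gamma> {-e<..<e}" "\<gamma> ` {-e<..<e} \<subseteq> S \<inter> U" "\<gamma> 0 = q"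
    "\<And>t. t \<in> {-e<..<e} \<Longrightarrow> (\<gamma> has_vector_derivative \<gamma>' t) (at t)" "\<gamma>' 0 = v"
  show thesis
    using that[OF g(1-4)] g(5)[of 0] g(1,6) by simp
qed

lemma tangent_space_iff:
  assumes "q \<in> S" "q \<in> U"
  shows "v \<in> tangent_space S q \<longleftrightarrow> D q v \<in> L"
proof
  assume "D q v \<in> L"
  from curve_with_velocity[OF assms this] obtain e \<gamma> where
    "e > 0" "smooth_on \<gamma> {-e<..<e}" "\<gamma> ` {-e<..<e} \<subseteq> S \<inter> U" "\<gamma> 0 = q"
    "(\<gamma> has_vector_derivative v) (at (0::real))" .
  then show "v \<in> tangent_space S q"
    unfolding tangent_space_def mem_Collect_eq by (intro exI[of _ e] exI[of _ \<gamma>] conjI) auto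
next
  assume "v \<in> tangent_space S q"
  then obtain e \<gamma> where g: "e > 0" "\<gamma> ` {-e<..<e} \<subseteq> S" "\<gamma> 0 = q"
    "(\<gamma> has_vector_derivative v) (at (0::real))"
    unfolding tangent_space_def by blast
  have "((\<lambda>t. \<phi> (\<gamma> t)) has_vector_derivative D q v) (at 0)"
    using has_vector_derivative_compose_derivative[OF g(4)] D_deriv[OF assms(2)] g(3) by blast
  moreover have "\<forall>\<^sub>F t in nhds 0. \<phi> (\<gamma> t) \<in> L"
  proof -
    have "isCont \<gamma> 0" using g(4) has_vector_derivative_continuous by blast
    then have "\<forall>\<^sub>F t in nhds 0. \<gamma> t \<in> U"
      using g(3) assms(2) open_U
      by (metis continuous_within tendsto_at_iff_tendsto_nhds topological_tendstoD)
    moreover have "\<forall>\<^sub>F t in nhds 0. t \<in> {-e<..<e}"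
      using g(1) by (intro eventually_nhds_in_open) auto
    ultimately show ?thesis
      by eventually_elim (use g(2) chart_slice in \<open>meson image_subset_iff\<close>)
  qed
  ultimately show "D q v \<in> L"
    by (rule has_vector_derivative_in_subspace[OF subspace_L])
qed

lemma subspace_tangent_space:
  assumes "q \<in> S" "q \<in> U"
  shows "subspace (tangent_space S q)"
proof -
  have "tangent_space S q = {v. D q v \<in> L}" using tangent_space_iff[OF assms] by auto
  moreover have "subspace {v. D q v \<in> L}"
    using linear_D[OF assms(2)] subspace_L
    unfolding subspace_def by (simp add: linear_0 linear_add linear_cmul)
  ultimately show ?thesis by simp
qed

lemma dim_tangent_space:
  assumes "q \<in> S" "q \<in> U"
  shows "dim (tangent_space S q) = dim L"
proof -
  have lE: "linear (E (\<phi> q))"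
    using E_deriv[OF chart_in[OF assms(2)]] has_derivative_linear by blast
  have "tangent_space S q = E (\<phi> q) ` L"
    using tangent_space_iff[OF assms] E_D[OF assms(2)] D_E[OF assms(2)]
    by (auto simp: image_iff) metis
  moreover have "inj (E (\<phi> q))"
    using D_E[OF assms(2)] by (metis injI)
  ultimately show ?thesis
    using dim_image_eq[OF lE] inj_on_subset by fastforce
qed

text \<open>Differentiating \<open>D q (Y q) \<in> L\<close> along \<open>S\<close> shows that \<open>D z a + Q z v w \<in> L\<close> characterizes the
  second fundamental form \<open>a\<close> at \<open>(v, w)\<close> up to tangent vectors, whatever the field \<open>Y\<close>.\<close>

definition Q :: "'a \<Rightarrow> 'a \<Rightarrow> 'a \<Rightarrow> 'a" where
  "Q z v w = (\<Sum>i\<in>Basis. (w \<bullet> i) *\<^sub>R frechet_derivative (\<lambda>x. D x i) (at z) v)"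

lemma D_along_curve:
  assumes g: "(\<gamma> has_vector_derivative v) (at 0)" and X: "(X has_vector_derivative X') (at 0)"
    and z: "\<gamma> 0 = z" "z \<in> U"
  shows "((\<lambda>t. D (\<gamma> t) (X t)) has_vector_derivative D z X' + Q z v (X 0)) (at (0::real))"
proof -
  have "isCont \<gamma> 0" using g has_vector_derivative_continuous by blast
  then have "\<forall>\<^sub>F t in nhds 0. \<gamma> t \<in> U"
    using z open_U
    by (metis continuous_within tendsto_at_iff_tendsto_nhds topological_tendstoD)
  then obtain T where T: "open T" "0 \<in> T" "\<And>t. t \<in> T \<Longrightarrow> \<gamma> t \<in> U"
    unfolding eventually_nhds by blast
  \<comment> \<open>Expansion in \<open>Basis\<close> allows the product rule: differentiating the
    coefficients gives \<open>D z X'\<close>, differentiating \<open>D\<close> along the curve gives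
    \<open>Q\<close>.\<close>
  have "((\<lambda>t. \<Sum>i\<in>Basis. (X t \<bullet> i) *\<^sub>R D (\<gamma> t) i) has_vector_derivative
      (\<Sum>i\<in>Basis. (X 0 \<bullet> i) *\<^sub>R frechet_derivative (\<lambda>x. D x i) (at z) v + (X' \<bullet> i) *\<^sub>R D z i)) (at 0)"
  proof (rule has_vector_derivative_sum)
    fix i :: 'a
    have "((\<lambda>x. D x i) has_derivative frechet_derivative (\<lambda>x. D x i) (at z)) (at z)"
      using smooth_onD(2)[OF smooth_chart z(2)] frechet_derivative_works by blast
    then have a: "((\<lambda>t. D (\<gamma> t) i) has_vector_derivative frechet_derivative (\<lambda>x. D x i) (at z) v) (at 0)"
      using has_vector_derivative_compose_derivative[OF g, of "\<lambda>x. D x i"] z(1) by blast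
    have b: "((\<lambda>t. X t \<bullet> i) has_vector_derivative X' \<bullet> i) (at 0)"
      by (rule bounded_linear.has_vector_derivative[OF bounded_linear_inner_left X])
    then have b: "((\<lambda>t. X t \<bullet> i) has_field_derivative X' \<bullet> i) (at 0)"
      by (simp add: has_real_derivative_iff_has_vector_derivative)
    show "((\<lambda>t. (X t \<bullet> i) *\<^sub>R D (\<gamma> t) i) has_vector_derivative
       (X 0 \<bullet> i) *\<^sub>R frechet_derivative (\<lambda>x. D x i) (at z) v + (X' \<bullet> i) *\<^sub>R D z i) (at 0)"
      using has_vector_derivative_scaleR[OF b a] z(1) by simp
  qed
  moreover have "(\<Sum>i\<in>Basis. (X t \<bullet> i) *\<^sub>R D (\<gamma> t) i) = D (\<gamma> t) (X t)" if "t \<in> T" for t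
    by (rule linear_euclidean_expansion[OF linear_D[OF T(3)[OF that]], symmetric])
  ultimately have "((\<lambda>t. D (\<gamma> t) (X t)) has_vector_derivative
     (\<Sum>i\<in>Basis. (X 0 \<bullet> i) *\<^sub>R frechet_derivative (\<lambda>x. D x i) (at z) v + (X' \<bullet> i) *\<^sub>R D z i)) (at 0)"
    by (rule has_vector_derivative_transform_within_open[OF _ T(1,2)])
  then show ?thesis
    using linear_euclidean_expansion[OF linear_D[OF z(2)], of X']
    by (simp add: sum.distrib Q_def add.commute)
qed

text \<open>The chart velocity \<open>c\<close> is constant, so its derivative, computed by
  \<open>D_along_curve\<close>, vanishes. Compared with
  \<open>second_fundamental_form_props\<close>, this shows that \<open>a\<close> and the second
  fundamental form agree up to a tangent vector.\<close>

lemma acceleration: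
  assumes "z \<in> U" "\<gamma> 0 = z" "e > 0"
    and "\<And>t. t \<in> {-e<..<e} \<Longrightarrow> (\<gamma> has_vector_derivative \<gamma>' t) (at t)"
    and "(\<gamma>' has_vector_derivative a) (at (0::real))"
    and "\<And>t. t \<in> {-e<..<e} \<Longrightarrow> D (\<gamma> t) (\<gamma>' t) = c"
  shows "D z a + Q z (\<gamma>' 0) (\<gamma>' 0) = 0"
proof -
  have "((\<lambda>t. D (\<gamma> t) (\<gamma>' t)) has_vector_derivative D z a + Q z (\<gamma>' 0) (\<gamma>' 0)) (at 0)"
    using assms by (intro D_along_curve) auto
  moreover have "((\<lambda>t. D (\<gamma> t) (\<gamma>' t)) has_vector_derivative 0) (at 0)"
    by (rule has_vector_derivative_transform_within_open[of "\<lambda>t. c" _ _ "{-e<..<e}"])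
       (use assms in auto)
  ultimately show ?thesis
    by (rule vector_derivative_unique_at)
qed

text \<open>The \<open>THE\<close> in the definition has to be resolved. Every admissible field
  yields a vector satisfying \<open>P\<close>; two such vectors differ by a vector that is both
  tangent and normal, hence zero; and an admissible field exists.\<close>

lemma second_fundamental_form_props:
  assumes z: "z \<in> S" "z \<in> U" and v: "v \<in> tangent_space S z" and w: "w \<in> tangent_space S z"
  shows "second_fundamental_form S z v w \<in> orthogonal_comp (tangent_space S z)"
    and "D z (second_fundamental_form S z v w) + Q z v w \<in> L"
proof -
  let ?T = "tangent_space S z"
  define P where "P a \<longleftrightarrow> a \<in> orthogonal_comp ?T \<and> D z a + Q z v w \<in> L" for a
  let ?R = "\<lambda>a. \<exists>U Y. open U \<and> z \<in> U \<and> smooth_on Y U \<and>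
        (\<forall>q\<in>S \<inter> U. Y q \<in> tangent_space S q) \<and> Y z = w \<and>
        a = normal_part S z (frechet_derivative Y (at z) v)"
  have P_unique: "a = b" if "P a" "P b" for a b
  proof -
    have "a - b \<in> orthogonal_comp ?T"
      using that by (simp add: P_def subspace_diff subspace_orthogonal_comp)
    moreover have "D z (a - b) \<in> L"
      using subspace_diff[OF subspace_L, of "D z a + Q z v w" "D z b + Q z v w"] that
      by (simp add: P_def linear_diff[OF linear_D[OF z(2)]])
    then have "a - b \<in> ?T" using tangent_space_iff[OF z] by simp
    ultimately show "a = b" by (auto simp: orthogonal_comp_def orthogonal_def)
  qed
  have R_P: "P a" if R: "?R a" for a
  proof -
    obtain U' Y where Y: "open U'" "z \<in> U'" "smooth_on Y U'"
      "\<And>q. q \<in> S \<inter> U' \<Longrightarrow> Y q \<in> tangent_space S q" "Y z = w"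
      and a: "a = normal_part S z (frechet_derivative Y (at z) v)"
      using R by blast
    let ?d = "frechet_derivative Y (at z) v"
    have "D z v \<in> L" using v tangent_space_iff[OF z] by blast
    from curve_with_velocity[OF z this] obtain e \<gamma> where
      g: "e > 0" "smooth_on \<gamma> {-e<..<e}" "\<gamma> ` {-e<..<e} \<subseteq> S \<inter> U" "\<gamma> 0 = z"
        "(\<gamma> has_vector_derivative v) (at (0::real))" .
    have "(Y has_derivative frechet_derivative Y (at z)) (at z)"
      using smooth_onD(1)[OF Y(3,2)] frechet_derivative_works by blast
    then have dY: "((\<lambda>t. Y (\<gamma> t)) has_vector_derivative ?d) (at 0)"
      using has_vector_derivative_compose_derivative[OF g(5), of Y] g(4) by blast
    have "((\<lambda>t. D (\<gamma> t) (Y (\<gamma> t))) has_vector_derivative D z ?d + Q z v w) (at 0)"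
      using D_along_curve[OF g(5) dY g(4) z(2)] g Y(5) by simp
    moreover have "\<forall>\<^sub>F t in nhds 0. D (\<gamma> t) (Y (\<gamma> t)) \<in> L"
    proof -
      have "isCont \<gamma> 0" using g(5) has_vector_derivative_continuous by blast
      then have "\<forall>\<^sub>F t in nhds 0. \<gamma> t \<in> U'"
        using g(4) Y(1,2)
        by (metis continuous_within tendsto_at_iff_tendsto_nhds topological_tendstoD)
      moreover have "\<forall>\<^sub>F t in nhds 0. t \<in> {-e<..<e}"
        using g(1) by (intro eventually_nhds_in_open) auto
      ultimately show ?thesis
      proof eventually_elim
        case (elim t)
        then have "\<gamma> t \<in> S" "\<gamma> t \<in> U" using g(3) by auto
        then show ?case using tangent_space_iff Y(4) elim by blast
      qed
    qed
    ultimately have "D z ?d + Q z v w \<in> L"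
      by (rule has_vector_derivative_in_subspace[OF subspace_L])
    moreover have "D z (?d - a) \<in> L"
      using normal_part_props(2)[OF subspace_tangent_space[OF z]] tangent_space_iff[OF z] a by blast
    ultimately have "D z ?d + Q z v w - D z (?d - a) \<in> L"
      using subspace_diff[OF subspace_L] by blast
    moreover have "D z ?d + Q z v w - D z (?d - a) = D z a + Q z v w"
      by (simp add: linear_diff[OF linear_D[OF z(2)]])
    ultimately have "D z a + Q z v w \<in> L" by metis
    then show "P a"
      unfolding P_def using normal_part_props(1)[OF subspace_tangent_space[OF z]] a by blast
  qed
  have "\<exists>a. ?R a"
  proof -
    \<comment> \<open>The field that is constant in the chart: \<open>D q (Y q) = D z w\<close>
      throughout \<open>U\<close>, so \<open>Y\<close> is tangent along \<open>S\<close>.\<close>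
    define Y where "Y q = E (\<phi> q) (D z w)" for q
    have "smooth_on Y U"
      unfolding Y_def
      using smooth_on_compose[OF open_U _ smooth_chart, of V "\<lambda>x. E x (D z w)"]
        smooth_onD(3)[OF smooth_inv] chart_in chart_in[OF z(2)] by blast
    moreover have "Y q \<in> tangent_space S q" if "q \<in> S \<inter> U" for q
      using that w tangent_space_iff[OF z] tangent_space_iff[of q] D_E[of q] by (auto simp: Y_def)
    moreover have "Y z = w" by (simp add: Y_def E_D z)
    ultimately show ?thesis using open_U z(2) by blast
  qed
  then obtain a where a: "?R a" ..
  have "(THE a. ?R a) = a"
    by (rule the_equality, rule a) (rule P_unique[OF R_P R_P[OF a]])
  then have "P (second_fundamental_form S z v w)"
    unfolding second_fundamental_form_def using R_P[OF a] by (simp only:)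
  then show "second_fundamental_form S z v w \<in> orthogonal_comp (tangent_space S z)"
    "D z (second_fundamental_form S z v w) + Q z v w \<in> L"
    unfolding P_def by auto
qed

end


subsection \<open>Maximum principle on a shrinker\<close>

text \<open>Were \<open>l\<close> positive, \<open>f'\<close> would be positive just to the right of
  0, and the mean value theorem would give values above \<open>f 0\<close>.\<close>

lemma local_max_second_derivative:
  fixes f :: "real \<Rightarrow> real"
  assumes "e > 0" and df: "\<And>t. t \<in> {-e<..<e} \<Longrightarrow> (f has_real_derivative f' t) (at t)"
    and max: "\<And>t. t \<in> {-e<..<e} \<Longrightarrow> f t \<le> f 0"
    and df': "(f' has_real_derivative l) (at 0)"
  shows "f' 0 = 0" "l \<le> 0"
proof -
  show f0: "f' 0 = 0"
    by (rule DERIV_local_max[OF df, of 0 e]) (use assms in \<open>auto intro!: max simp: abs_less_iff\<close>)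
  show "l \<le> 0"
  proof (rule ccontr)
    assume "\<not> l \<le> 0"
    then obtain d where d: "d > 0" "\<And>h. 0 < h \<Longrightarrow> h < d \<Longrightarrow> f' 0 < f' h"
      using DERIV_pos_inc_right[OF df'] by auto
    define h where "h = min d e / 2"
    have h: "0 < h" "h < d" "h < e" using d(1) assms(1) by (auto simp: h_def)
    have "\<exists>c>0. c < h \<and> f h - f 0 = (h - 0) * f' c"
      by (rule MVT2[OF h(1)]) (use h assms(1) in \<open>auto intro!: df\<close>)
    then obtain c where c: "0 < c" "c < h" "f h - f 0 = h * f' c" by auto
    moreover have "f' c > 0" using d(2)[of c] c h f0 by simp
    ultimately have "f h > f 0" using h(1) by (metis mult_pos_pos diff_gt_0_iff_gt)
    then show False using max[of h] h assms(1) by simp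
  qed
qed

lemma trace_orthonormal:
  fixes H :: "'a::euclidean_space \<Rightarrow> 'a"
  assumes B: "pairwise orthogonal B" "\<And>b. b \<in> B \<Longrightarrow> norm b = 1" "finite B" "span B = UNIV"
    and "linear H"
  shows "(\<Sum>b\<in>B. H b \<bullet> b) = (\<Sum>b\<in>Basis. H b \<bullet> b)"
proof -
  have parseval: "x \<bullet> y = (\<Sum>b\<in>B. (x \<bullet> b) * (y \<bullet> b))" for x y :: 'a
  proof -
    have "x \<bullet> y = (\<Sum>b\<in>B. (x \<bullet> b) *\<^sub>R b) \<bullet> y"
      using orthonormal_basis_expand[OF B(1,2) _ B(3), of x] B(4) by simp
    then show ?thesis by (simp add: inner_sum_left inner_commute[of y])
  qed
  have "(\<Sum>b\<in>B. H b \<bullet> b) = (\<Sum>b\<in>B. \<Sum>i\<in>Basis. (b \<bullet> i) * (H i \<bullet> b))"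
    by (subst linear_euclidean_expansion[OF assms(5)]) (simp add: inner_sum_left)
  also have "\<dots> = (\<Sum>i\<in>Basis. \<Sum>b\<in>B. (H i \<bullet> b) * (i \<bullet> b))"
    by (subst sum.swap) (simp add: inner_commute mult.commute)
  finally show ?thesis by (simp flip: parseval)
qed

text \<open>At a maximum of \<open>G\<close> along \<open>S\<close> the gradient is normal, so only its pairing with the mean
  curvature survives in the second derivatives, and the shrinker equation evaluates it.  The
  conclusion says that the drift Laplacian of \<open>G\<close> is nonpositive there.\<close>

lemma shrinker_maximum_principle:
  fixes S :: "'a::euclidean_space set"
  assumes dim: "DIM('a) = n + 1" and S: "shrinker n S" and z: "z \<in> S" and X: "open X" "z \<in> X"
    and max: "\<And>x. x \<in> S \<Longrightarrow> x \<in> X \<Longrightarrow> G x \<le> G z"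
    and dG: "\<And>x. x \<in> X \<Longrightarrow> (G has_derivative (\<lambda>d. g x \<bullet> d)) (at x)"
    and dg: "(g has_derivative H) (at z)"
  obtains \<nu> c where "norm \<nu> = 1" "g z = c *\<^sub>R \<nu>"
    "(\<Sum>b\<in>Basis. H b \<bullet> b) - H \<nu> \<bullet> \<nu> - g z \<bullet> z / 2 \<le> 0"
proof -
  obtain U V \<phi> \<psi> L where "slice_chart S U V L \<phi> \<psi>" and zU: "z \<in> U" and dimL: "dim L = n"
    using S z unfolding shrinker_def submanifold_def slice_chart_def by metis
  then interpret slice_chart S U V L \<phi> \<psi> by simp
  let ?T = "tangent_space S z" and ?A = "second_fundamental_form S z"
  have T: "subspace ?T" "dim ?T = n"
    using subspace_tangent_space dim_tangent_space z zU dimL by auto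
  \<comment> \<open>Here \<open>a\<close> is the acceleration of a curve in \<open>S\<close> with
    velocity \<open>e\<close>, and the first and second derivative tests are applied to
    \<open>G\<close> along it. As \<open>a\<close> differs from \<open>?A e e\<close> by a tangent
    vector, which \<open>g z\<close> annihilates, \<open>dir\<close> can replace one by the
    other.\<close>
  have tangent: "g z \<bullet> e = 0 \<and> (\<exists>a. H e \<bullet> e + g z \<bullet> a \<le> 0 \<and> ?A e e - a \<in> ?T)" if e: "e \<in> ?T" for e
  proof -
    have "D z e \<in> L" using e tangent_space_iff z zU by blast
    then show ?thesis
    proof (rule straight_curve[OF z zU])
      fix \<epsilon> \<gamma> \<gamma>' a assume c: "\<epsilon> > 0" "smooth_on \<gamma> {-\<epsilon><..<\<epsilon>}"
        "\<gamma> ` {-\<epsilon><..<\<epsilon>} \<subseteq> S \<inter> U" "\<gamma> 0 = z"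
        "\<And>t. t \<in> {-\<epsilon><..<\<epsilon>} \<Longrightarrow> (\<gamma> has_vector_derivative \<gamma>' t) (at t)" "\<gamma>' 0 = e"
        "(\<gamma>' has_vector_derivative a) (at 0)"
        "\<And>t. t \<in> {-\<epsilon><..<\<epsilon>} \<Longrightarrow> D (\<gamma> t) (\<gamma>' t) = D z e"
      have c0: "(\<gamma> has_vector_derivative e) (at 0)" using c(5)[of 0] c(1,6) by simp
      have "isCont \<gamma> 0" using c0 has_vector_derivative_continuous by blast
      then have "\<forall>\<^sub>F t in nhds 0. \<gamma> t \<in> X"
        using X c(4) by (metis continuous_within tendsto_at_iff_tendsto_nhds topological_tendstoD)
      then obtain \<delta>0 where \<delta>0: "\<delta>0 > 0" "\<And>t. dist t 0 < \<delta>0 \<Longrightarrow> \<gamma> t \<in> X"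
        unfolding eventually_nhds_metric by blast
      define \<delta> where "\<delta> = min \<epsilon> \<delta>0"
      have sub: "t \<in> {-\<epsilon><..<\<epsilon>}" "\<gamma> t \<in> X" if "t \<in> {-\<delta><..<\<delta>}" for t
        using c(1) \<delta>0(1) that \<delta>0(2)[of t] by (auto simp: \<delta>_def dist_real_def)
      have \<delta>: "\<delta> > 0" using c(1) \<delta>0(1) by (simp add: \<delta>_def)
      have d1: "((\<lambda>t. G (\<gamma> t)) has_real_derivative g (\<gamma> t) \<bullet> \<gamma>' t) (at t)" if "t \<in> {-\<delta><..<\<delta>}" for t
        unfolding has_real_derivative_iff_has_vector_derivative
        by (rule has_vector_derivative_compose_derivative[OF c(5)[OF sub(1)[OF that]] dG[OF sub(2)[OF that]]])
      have dg': "((\<lambda>t. g (\<gamma> t)) has_vector_derivative H e) (at 0)"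
        using has_vector_derivative_compose_derivative[OF c0] dg c(4) by blast
      have d2: "((\<lambda>t. g (\<gamma> t) \<bullet> \<gamma>' t) has_real_derivative H e \<bullet> e + g z \<bullet> a) (at 0)"
        using bounded_bilinear.has_vector_derivative[OF bounded_bilinear_inner dg' c(7)] c(4,6)
        by (simp add: has_real_derivative_iff_has_vector_derivative add.commute)
      have m: "G (\<gamma> t) \<le> G (\<gamma> 0)" if "t \<in> {-\<delta><..<\<delta>}" for t
      proof -
        have "\<gamma> t \<in> S" using sub(1)[OF that] c(3) by blast
        then show ?thesis using max sub(2)[OF that] c(4) by simp
      qed
      note second = local_max_second_derivative[OF \<delta> d1 m d2]
      have ge: "g z \<bullet> e = 0" using second(1) c(4,6) by simp
      have "D z a + Q z e e = 0"
        using acceleration[OF zU c(4,1,5,7,8)] c(6) by simp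
      moreover have "D z (?A e e) + Q z e e \<in> L"
        using second_fundamental_form_props(2)[OF z zU e e] .
      ultimately have "D z (?A e e - a) \<in> L"
        by (metis add_diff_cancel_right diff_0_right linear_diff[OF linear_D[OF zU]])
      then have "?A e e - a \<in> ?T" using tangent_space_iff z zU by blast
      then show ?thesis using ge second(2) c(4,6) by auto
    qed
  qed
  have dir: "g z \<bullet> e = 0 \<and> H e \<bullet> e + g z \<bullet> ?A e e \<le> 0" if e: "e \<in> ?T" for e
  proof -
    obtain a where a: "H e \<bullet> e + g z \<bullet> a \<le> 0" "?A e e - a \<in> ?T" using tangent[OF e] by blast
    have "g z \<bullet> (?A e e - a) = 0" using tangent[OF a(2)] by blast
    then show ?thesis using a(1) tangent[OF e] by (simp add: inner_diff_right)
  qed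
  define B where "B = (SOME B. orthonormal_basis_of ?T B)"
  have "\<exists>B. orthonormal_basis_of ?T B"
    using orthonormal_basis_subspace[OF T(1)] unfolding orthonormal_basis_of_def by metis
  then have "orthonormal_basis_of ?T B" unfolding B_def by (rule someI_ex)
  then have B: "B \<subseteq> ?T" "pairwise orthogonal B" "\<And>b. b \<in> B \<Longrightarrow> norm b = 1" "span B = ?T"
    unfolding orthonormal_basis_of_def by auto
  have finB: "finite B"
    using B(2) pairwise_orthogonal_imp_finite by blast
  \<comment> \<open>In codimension one a single unit normal completes \<open>B\<close> to an
    orthonormal basis of the whole space. This makes \<open>g z\<close> a multiple of \<nu> and
    reduces the tangential trace to the full trace minus one term.\<close>
  obtain x where x: "x \<noteq> 0" "\<And>y. y \<in> span ?T \<Longrightarrow> orthogonal x y"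
    using orthogonal_to_subspace_exists[of ?T] T dim by auto
  define \<nu> where "\<nu> = x /\<^sub>R norm x"
  have \<nu>: "norm \<nu> = 1" "\<And>y. y \<in> ?T \<Longrightarrow> \<nu> \<bullet> y = 0"
    using x span_base[of _ ?T] by (auto simp: \<nu>_def orthogonal_def)
  have \<nu>B: "\<nu> \<notin> B" using \<nu> B(1) by force
  have B': "pairwise orthogonal (insert \<nu> B)" "\<And>b. b \<in> insert \<nu> B \<Longrightarrow> norm b = 1" "finite (insert \<nu> B)"
    using B \<nu> finB by (auto simp: pairwise_insert orthogonal_def inner_commute)
  have "0 \<notin> insert \<nu> B" using B'(2) by force
  then have ind: "independent (insert \<nu> B)" using B'(1) pairwise_orthogonal_independent by blast
  then have "card B = n"
    using independent_mono[OF ind subset_insertI] B(4) T(2) dim_span_eq_card_independent[of B] by auto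
  then have "card (insert \<nu> B) = DIM('a)" using dim finB \<nu>B by simp
  then have span: "span (insert \<nu> B) = UNIV"
    using ind by (metis dim_eq_card_independent dim_eq_full)
  have gB: "g z \<bullet> b = 0" if "b \<in> B" for b using dir B(1) that by blast
  have "g z = (g z \<bullet> \<nu>) *\<^sub>R \<nu>"
    using orthonormal_basis_expand[OF B'(1,2) _ B'(3), of "g z"] span finB \<nu>B gB by simp
  moreover have "(\<Sum>b\<in>Basis. H b \<bullet> b) - H \<nu> \<bullet> \<nu> = (\<Sum>b\<in>B. H b \<bullet> b)"
    using trace_orthonormal[OF B' span has_derivative_linear[OF dg]] finB \<nu>B by simp
  \<comment> \<open>The shrinker equation turns the sum of the \<open>?A b b\<close> into minus half
    the normal part of \<open>z\<close>; since \<open>g z\<close> is normal, the normal part may be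
    replaced by \<open>z\<close> itself.\<close>
  moreover have "(\<Sum>b\<in>B. g z \<bullet> ?A b b) = - (g z \<bullet> z) / 2"
  proof -
    have "- (\<Sum>b\<in>B. ?A b b) = (1/2) *\<^sub>R normal_part S z z"
      using S z unfolding shrinker_def mean_curvature_def B_def by blast
    then have "(\<Sum>b\<in>B. g z \<bullet> ?A b b) = - (1/2) * (g z \<bullet> normal_part S z z)"
      by (metis inner_minus_right inner_scaleR_right inner_sum_right minus_equation_iff mult_minus_left)
    moreover have "g z \<bullet> (z - normal_part S z z) = 0"
      using dir normal_part_props(2)[OF T(1)] by blast
    ultimately show ?thesis by (simp add: inner_diff_right)
  qed
  moreover have "(\<Sum>b\<in>B. H b \<bullet> b) + (\<Sum>b\<in>B. g z \<bullet> ?A b b) \<le> 0"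
    unfolding sum.distrib[symmetric] using dir B(1) by (intro sum_nonpos) auto
  ultimately show ?thesis
    using that[OF \<nu>(1), of "g z \<bullet> \<nu>"] by simp
qed


subsection \<open>Comparison with a barrier function\<close>

text \<open>The Hessian of a Gaussian barrier is a multiple of the identity plus a rank-one map
  along \<open>u = z - y\<close>. This computes the trace after such a term is added to
  \<open>A\<close>, the Hessian of \<open>v\<close>.\<close>

lemma trace_rank_one:
  fixes A :: "'a::euclidean_space \<Rightarrow> 'a"
  shows "(\<Sum>b\<in>Basis. (A b + (s *\<^sub>R b + (t * (u \<bullet> b)) *\<^sub>R u)) \<bullet> b)
    = (\<Sum>b\<in>Basis. A b \<bullet> b) + s * DIM('a) + t * (norm u)\<^sup>2"
proof -
  have "(\<Sum>b\<in>Basis. t * (u \<bullet> b) * (u \<bullet> b)) = t * (norm u)\<^sup>2"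
    by (simp add: power2_norm_eq_inner euclidean_inner[of u u] sum_distrib_left mult.assoc)
  moreover have "(\<Sum>b\<in>(Basis :: 'a set). (s *\<^sub>R b) \<bullet> b) = s * DIM('a)"
    by (simp add: inner_Basis)
  ultimately show ?thesis
    by (simp only: inner_add_left sum.distrib inner_scaleR_left)
qed

text \<open>\<open>g\<close> and \<open>H\<close> are the gradient and the Hessian of \<open>v\<close>, and \<open>not_normal\<close> says that short chords
  of \<open>C\<close> are not normal to \<open>C\<close>.  The map \<open>x \<mapsto> (\<pi> x, v x)\<close> is a collar of \<open>C\<close>; it replaces
  charts of \<open>C\<close>.\<close>

locale comparison =
  fixes S C X Z :: "'a::euclidean_space set" and n :: nat
    and v :: "'a \<Rightarrow> real" and g :: "'a \<Rightarrow> 'a" and H :: "'a \<Rightarrow> 'a \<Rightarrow> 'a"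
    and \<theta> :: "'a \<Rightarrow> real" and M r :: real and \<pi> :: "'a \<Rightarrow> 'a"
  assumes dim: "DIM('a) = n + 1" and shrinker: "shrinker n S" and closed_S: "closed S"
    and open_X: "open X" and S_X: "S \<subseteq> X"
    and dv: "x \<in> X \<Longrightarrow> (v has_derivative (\<lambda>d. g x \<bullet> d)) (at x)"
    and dg: "x \<in> X \<Longrightarrow> (g has_derivative H x) (at x)"
    and drift: "\<lbrakk>x \<in> S; norm \<nu> = 1\<rbrakk> \<Longrightarrow> \<theta> x \<le> (\<Sum>b\<in>Basis. H x b \<bullet> b) - H x \<nu> \<bullet> \<nu> - g x \<bullet> x / 2"
    and \<theta>_nonneg: "x \<in> S \<Longrightarrow> 0 \<le> \<theta> x" and \<theta>_zero: "\<lbrakk>x \<in> S; \<theta> x = 0\<rbrakk> \<Longrightarrow> x \<in> C"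
    and cont_\<theta>: "continuous_on S \<theta>"
    and v_le: "x \<in> S \<Longrightarrow> v x \<le> M" and v_eq: "\<lbrakk>x \<in> S; v x = M\<rbrakk> \<Longrightarrow> x \<in> C" and v_C: "x \<in> C \<Longrightarrow> v x = M"
    and r_pos: "0 < r"
    and not_normal: "\<lbrakk>p \<in> C; y \<in> C; p \<noteq> y; dist p y < r\<rbrakk> \<Longrightarrow>
       ((p - y) \<bullet> g p)\<^sup>2 < (norm (p - y))\<^sup>2 * (norm (g p))\<^sup>2"
    and closed_C: "closed C" and connected_C: "connected C"
    and open_Z: "open Z" and C_Z: "C \<subseteq> Z" and Z_X: "Z \<subseteq> X"
    and cont_\<pi>: "continuous_on Z \<pi>" and \<pi>_C: "\<pi> ` Z \<subseteq> C" and \<pi>_id: "x \<in> C \<Longrightarrow> \<pi> x = x"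
    and inj_\<pi>: "inj_on (\<lambda>x. (\<pi> x, v x)) Z"
begin

section \<open>Existence of contact points\<close>

lemma cont_v: "continuous_on X v"
  using dv by (meson continuous_at_imp_continuous_on has_derivative_continuous)

lemma cont_g: "continuous_on X g"
  using dg by (meson continuous_at_imp_continuous_on has_derivative_continuous)

text \<open>The function \<open>|x|\<^sup>2\<close> is proper and its drift Laplacian is \<open>2 n - |x|\<^sup>2\<close>, so penalizing \<open>v\<close>
  by a small multiple of it produces maxima that stay in a fixed ball.\<close>

lemma penalized_max:
  fixes \<epsilon> :: real
  assumes S': "S' \<subseteq> S" "closed S'" "S' \<noteq> {}" "open Y" "S' = S \<inter> Y" and "\<epsilon> > 0"
  obtains z where "z \<in> S'" "z \<bullet> z \<le> 2 * real n" "\<theta> z \<le> 2 * real n * \<epsilon>"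
proof -
  define f where "f x = v x - \<epsilon> * (x \<bullet> x)" for x
  obtain x0 where x0: "x0 \<in> S'" using S'(3) by blast
  \<comment> \<open>Beyond radius \<open>R\<close> the penalty alone pushes \<open>f\<close> down to
    \<open>f x0\<close> or below, so a maximum over the compact part is global on \<open>S'\<close>.
    The summand 1 gives \<open>R \<le> R\<^sup>2\<close>.\<close>
  define R where "R = norm x0 + \<bar>M - f x0\<bar> / \<epsilon> + 1"
  have R: "norm x0 \<le> R" "1 \<le> R" "\<bar>M - f x0\<bar> / \<epsilon> \<le> R"
    using \<open>\<epsilon> > 0\<close> by (simp_all add: R_def)
  have "M - f x0 \<le> \<epsilon> * R" using R(3) \<open>\<epsilon> > 0\<close> by (simp add: field_simps)
  also have "\<dots> \<le> \<epsilon> * R\<^sup>2" using R(2) \<open>\<epsilon> > 0\<close> by (simp add: power2_eq_square)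
  finally have R2: "M - \<epsilon> * R\<^sup>2 \<le> f x0" by simp
  have "continuous_on X f" unfolding f_def by (intro continuous_intros cont_v)
  then have "continuous_on (S' \<inter> cball 0 R) f"
    by (rule continuous_on_subset) (use S'(1) S_X in auto)
  moreover have "compact (S' \<inter> cball 0 R)" using S'(2) by (simp add: closed_Int_compact)
  moreover have x0': "x0 \<in> S' \<inter> cball 0 R" using x0 R(1) by simp
  ultimately obtain z where z: "z \<in> S' \<inter> cball 0 R" "\<And>x. x \<in> S' \<inter> cball 0 R \<Longrightarrow> f x \<le> f z"
    using continuous_attains_sup[of "S' \<inter> cball 0 R" f] by blast
  have zmax: "f x \<le> f z" if "x \<in> S'" for x
  proof (cases "norm x \<le> R")
    case True
    then show ?thesis using z(2) that by simp
  next
    case False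
    then have "R\<^sup>2 \<le> x \<bullet> x" using R(2) by (simp add: power2_norm_eq_inner[symmetric])
    then have "f x \<le> M - \<epsilon> * R\<^sup>2"
      unfolding f_def using v_le[of x] that S'(1) \<open>\<epsilon> > 0\<close> by (smt (verit) mult_left_mono subsetD)
    also have "\<dots> \<le> f z" using R2 z(2)[OF x0'] by simp
    finally show ?thesis .
  qed
  have zS: "z \<in> S" "z \<in> X \<inter> Y" using z(1) S' S_X by auto
  have 1: "(f has_derivative (\<lambda>d. (g x - (2 * \<epsilon>) *\<^sub>R x) \<bullet> d)) (at x)" if "x \<in> X \<inter> Y" for x
    unfolding f_def using that
    by (auto intro!: derivative_eq_intros dv simp: inner_diff_left inner_commute algebra_simps)
  have 2: "((\<lambda>x. g x - (2 * \<epsilon>) *\<^sub>R x) has_derivative (\<lambda>d. H z d - (2 * \<epsilon>) *\<^sub>R d)) (at z)"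
    using zS by (auto intro!: derivative_eq_intros dg)
  obtain \<nu> c where \<nu>: "norm \<nu> = 1" "(\<Sum>b\<in>Basis. (H z b - (2 * \<epsilon>) *\<^sub>R b) \<bullet> b) - (H z \<nu> - (2 * \<epsilon>) *\<^sub>R \<nu>) \<bullet> \<nu>
      - (g z - (2 * \<epsilon>) *\<^sub>R z) \<bullet> z / 2 \<le> 0"
    by (rule shrinker_maximum_principle[OF dim shrinker zS(1) open_Int[OF open_X S'(4)] zS(2) _ 1 2])
       (use zmax S'(5) in auto)
  \<comment> \<open>The identity has trace \<open>n + 1\<close> in the ambient space; subtracting
    the \<nu> direction leaves the \<open>n\<close> of the drift Laplacian of |x|^2.\<close>
  have trace: "(\<Sum>b\<in>Basis. (H z b - (2 * \<epsilon>) *\<^sub>R b) \<bullet> b) = (\<Sum>b\<in>Basis. H z b \<bullet> b) - 2 * \<epsilon> * (real n + 1)"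
    by (simp add: inner_diff_left sum_subtractf dim)
  have "\<nu> \<bullet> \<nu> = 1" using \<nu>(1) by (simp add: norm_eq_1)
  then have "\<theta> z \<le> 2 * \<epsilon> * n - \<epsilon> * (z \<bullet> z)"
    using \<nu>(2)[unfolded trace] drift[OF zS(1) \<nu>(1)]
    by (simp add: inner_diff_left algebra_simps diff_divide_distrib)
  moreover have "0 \<le> \<epsilon> * (z \<bullet> z)" using \<open>\<epsilon> > 0\<close> by simp
  moreover have "0 \<le> \<theta> z" using \<theta>_nonneg zS(1) by blast
  ultimately have "\<theta> z \<le> 2 * real n * \<epsilon>" "\<epsilon> * (z \<bullet> z) \<le> \<epsilon> * (2 * real n)" by (simp_all add: algebra_simps)
  then show ?thesis using that[of z] z(1) \<open>\<epsilon> > 0\<close> by simp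
qed

text \<open>The points supplied by \<open>penalized_max\<close> all lie in the compact set
  \<open>K\<close>. A minimizer of \<theta> on \<open>K\<close> therefore satisfies the bound for
  every \<epsilon>, so \<theta> vanishes there and the point is in \<open>C\<close>. Relative
  openness \<open>S' = S \<inter> Y\<close> makes a maximum on \<open>S'\<close> a local maximum on
  \<open>S\<close>.\<close>

lemma touches:
  assumes S': "S' \<subseteq> S" "closed S'" "S' \<noteq> {}" "open Y" "S' = S \<inter> Y"
  shows "S' \<inter> C \<noteq> {}"
proof -
  define K where "K = S' \<inter> cball 0 (sqrt (2 * real n))"
  have K: "z \<in> K" if "z \<in> S'" "z \<bullet> z \<le> 2 * real n" for z
    using that by (simp add: K_def norm_eq_sqrt_inner)
  have "K \<noteq> {}" using penalized_max[OF S', of 1] K by (metis empty_iff zero_less_one)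
  moreover have "compact K" unfolding K_def using S'(2) by (simp add: closed_Int_compact)
  moreover have "continuous_on K \<theta>"
    by (rule continuous_on_subset[OF cont_\<theta>]) (use S'(1) in \<open>auto simp: K_def\<close>)
  ultimately obtain z where z: "z \<in> K" "\<And>x. x \<in> K \<Longrightarrow> \<theta> z \<le> \<theta> x"
    using continuous_attains_inf by metis
  have zS: "z \<in> S'" "z \<in> S" using z(1) S'(1) by (auto simp: K_def)
  have small: "\<theta> z \<le> 2 * real n * \<epsilon>" if "\<epsilon> > 0" for \<epsilon>
    using penalized_max[OF S' that] K z(2) by (metis order_trans)
  have "\<theta> z \<le> 0"
  proof (rule field_le_epsilon)
    fix e :: real assume "e > 0"
    \<comment> \<open>The added 1 in the denominator covers \<open>n = 0\<close>.\<close>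
    then have "\<theta> z \<le> 2 * real n * (e / (2 * real n + 1))" by (intro small) simp
    also have "\<dots> \<le> e" using \<open>e > 0\<close> by (simp add: field_simps)
    finally show "\<theta> z \<le> 0 + e" by simp
  qed
  then show ?thesis using \<theta>_nonneg[OF zS(2)] \<theta>_zero[OF zS(2)] zS(1) by auto
qed

text \<open>Hopf's argument. If the contact set \<open>T\<close> is not all of \<open>C\<close>,
  connectedness gives a point \<open>y0\<close> of \<open>C - T\<close> close to \<open>T\<close>;
  let \<open>p\<close> be a point of \<open>T\<close> nearest to it. A Gaussian barrier
  \<open>h\<close>, positive inside a ball that meets \<open>T\<close> only at \<open>p\<close>, is
  added to \<open>v\<close> with a small factor. The sum has an interior maximum near
  \<open>p\<close>, where its drift Laplacian is nevertheless positive.\<close>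

lemma C_subset_S: "C \<subseteq> S"
proof (rule ccontr)
  assume "\<not> C \<subseteq> S"
  define T where "T = S \<inter> C"
  have "T \<noteq> {}"
    using touches[of S UNIV] closed_S shrinker by (auto simp: T_def shrinker_def)
  have closed_T: "closed T" unfolding T_def by (intro closed_Int closed_S closed_C)
  have "closedin (top_of_set C) T" using closed_T by (auto simp: T_def closedin_closed)
  then have "\<not> openin (top_of_set C) T"
    using connected_C \<open>T \<noteq> {}\<close> \<open>\<not> C \<subseteq> S\<close> unfolding connected_clopen T_def by blast
  then obtain p0 where p0: "p0 \<in> T" "\<And>e. e > 0 \<Longrightarrow> \<exists>y\<in>C. dist y p0 < e \<and> y \<notin> T"
    unfolding openin_euclidean_subtopology_iff by (auto simp: T_def)
  obtain y0 where y0: "y0 \<in> C" "dist y0 p0 < r / 2" "y0 \<notin> T"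
    using p0(2)[of "r / 2"] r_pos by auto
  obtain p where p: "p \<in> T" "\<And>x. x \<in> T \<Longrightarrow> dist y0 p \<le> dist y0 x"
    using distance_attains_inf[OF closed_T \<open>T \<noteq> {}\<close>] by blast
  have pS: "p \<in> S" "p \<in> C" "p \<in> X" using p(1) S_X by (auto simp: T_def)
  have ne: "p \<noteq> y0" using p(1) y0(3) by blast
  have "dist p y0 < r" using p(2)[OF p0(1)] y0(2) r_pos by (simp add: dist_commute)
  note nn = not_normal[OF pS(2) y0(1) ne this]
  \<comment> \<open>The ball with diameter from \<open>p\<close> to \<open>y0\<close> is internally
    tangent at \<open>p\<close> to the ball about \<open>y0\<close> through \<open>p\<close>. The
    latter has no point of \<open>T\<close> in its interior, so the smaller closed ball meets
    \<open>T\<close> only at \<open>p\<close>.\<close>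
  define y where "y = midpoint p y0"
  define \<rho> where "\<rho> = dist p y0 / 2"
  have \<rho>: "\<rho> > 0" using ne by (simp add: \<rho>_def)
  have "2 *\<^sub>R (p - y) = p - y0"
    unfolding y_def midpoint_def by (simp add: scaleR_right_diff_distrib scaleR_2)
  from arg_cong[OF this, of "(*\<^sub>R) (1/2)"] have py: "p - y = (1/2) *\<^sub>R (p - y0)" by simp
  have dpy: "norm (p - y) = \<rho>" by (simp add: py \<rho>_def dist_norm)
  have touch: "x = p" if "x \<in> T" "dist x y \<le> \<rho>" for x
  proof -
    have "(norm (x - p))\<^sup>2 + (norm (x - y0))\<^sup>2 = 2 * (norm (x - y))\<^sup>2 + (norm (p - y0))\<^sup>2 / 2"
      unfolding y_def midpoint_def power2_norm_eq_inner
      by (simp add: inner_diff_left inner_diff_right inner_add_left inner_add_right inner_commute field_simps)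
    moreover have "(norm (p - y0))\<^sup>2 = 4 * \<rho>\<^sup>2" by (simp add: \<rho>_def dist_norm power_divide)
    moreover have "(2 * \<rho>)\<^sup>2 \<le> (norm (x - y0))\<^sup>2"
      using p(2)[OF that(1)] \<rho> by (intro power_mono) (simp_all add: \<rho>_def dist_norm norm_minus_commute)
    moreover have "(norm (x - y))\<^sup>2 \<le> \<rho>\<^sup>2"
      using that(2) by (intro power_mono) (simp_all add: dist_norm)
    moreover have "(2 * \<rho>)\<^sup>2 = 4 * \<rho>\<^sup>2" by (simp add: power_mult_distrib)
    ultimately have "(norm (x - p))\<^sup>2 \<le> 0" by linarith
    then show ?thesis by simp
  qed
  \<comment> \<open>Half of the strict gap in \<open>not_normal\<close>, normalized by the gradient,
    so that \<Psi> is positive at \<open>(p, g p)\<close> and, by continuity, nearby. As \<Psi> is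
    homogeneous of degree 2 in its second argument, positivity at \<open>c *\<^sub>R \<nu>\<close>
    bounds the squared component of \<open>z - y\<close> orthogonal to \<nu> from below by \<kappa>,
    whatever \<open>c\<close> is.\<close>
  define \<kappa> where "\<kappa> = ((norm (p - y))\<^sup>2 * (norm (g p))\<^sup>2 - ((p - y) \<bullet> g p)\<^sup>2) / (2 * (norm (g p))\<^sup>2)"
  define \<Psi> where "\<Psi> q = (norm (fst q - y))\<^sup>2 * (norm (snd q))\<^sup>2 - ((fst q - y) \<bullet> snd q)\<^sup>2
     - \<kappa> * (norm (snd q))\<^sup>2" for q :: "'a \<times> 'a"
  have pos: "0 < (norm (p - y))\<^sup>2 * (norm (g p))\<^sup>2 - ((p - y) \<bullet> g p)\<^sup>2"
    using nn by (simp add: py power_mult_distrib power_divide)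
  have gp: "0 < (norm (g p))\<^sup>2" using pos by (cases "g p = 0") auto
  have \<kappa>: "\<kappa> > 0" unfolding \<kappa>_def using pos gp by simp
  have "\<kappa> * (norm (g p))\<^sup>2 = ((norm (p - y))\<^sup>2 * (norm (g p))\<^sup>2 - ((p - y) \<bullet> g p)\<^sup>2) / 2"
    using gp by (simp add: \<kappa>_def)
  then have "\<Psi> (p, g p) > 0" unfolding \<Psi>_def using pos by simp
  moreover have "continuous_on UNIV \<Psi>" unfolding \<Psi>_def by (intro continuous_intros)
  ultimately have "open (\<Psi> -` {0<..})" "(p, g p) \<in> \<Psi> -` {0<..}"
    using open_vimage[OF open_greaterThan] by auto
  then obtain A B where AB: "open A" "open B" "p \<in> A" "g p \<in> B" "A \<times> B \<subseteq> \<Psi> -` {0<..}"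
    by (metis open_prod_elim mem_Times_iff fst_conv snd_conv)
  obtain \<beta> where \<beta>: "\<beta> > 0" "ball (g p) \<beta> \<subseteq> B" using AB(2,4) openE by blast
  have "open (X \<inter> g -` ball (g p) (\<beta> / 2))"
    using continuous_open_preimage[OF cont_g open_X] by blast
  then have "open (A \<inter> (X \<inter> g -` ball (g p) (\<beta> / 2)))" "p \<in> A \<inter> (X \<inter> g -` ball (g p) (\<beta> / 2))"
    using AB(1,3) pS(3) \<beta>(1) by auto
  then obtain \<delta> where \<delta>: "\<delta> > 0" "cball p \<delta> \<subseteq> A \<inter> (X \<inter> g -` ball (g p) (\<beta> / 2))"
    by (meson open_contains_cball)
  have \<Psi>_pos: "\<Psi> (z, w) > 0" if "z \<in> cball p \<delta>" "norm (w - g z) < \<beta> / 2" for z w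
  proof -
    have "z \<in> A" "dist (g p) (g z) < \<beta> / 2" using \<delta>(2) that(1) by auto
    moreover have "dist (g p) w \<le> dist (g p) (g z) + dist (g z) w" by (rule dist_triangle)
    ultimately have "w \<in> ball (g p) \<beta>" using that(2) by (simp add: dist_norm norm_minus_commute)
    then have "(z, w) \<in> A \<times> B" using \<beta>(2) \<open>z \<in> A\<close> by blast
    then show ?thesis using AB(5) by auto
  qed
  have not_normal_near: "\<kappa> \<le> (norm (z - y))\<^sup>2 - ((z - y) \<bullet> \<nu>)\<^sup>2"
    if "z \<in> cball p \<delta>" "norm (c *\<^sub>R \<nu> - g z) < \<beta> / 2" "norm \<nu> = 1" for z \<nu> c
  proof -
    have "0 < c\<^sup>2 * ((norm (z - y))\<^sup>2 - ((z - y) \<bullet> \<nu>)\<^sup>2 - \<kappa>)"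
      using \<Psi>_pos[OF that(1,2)] that(3) by (simp add: \<Psi>_def power_mult_distrib right_diff_distrib mult.commute)
    then show ?thesis by (simp add: zero_less_mult_iff)
  qed
  define K where "K = (\<delta> + \<rho>) * (\<delta> + norm p)"
  have near: "norm (z - y) \<le> \<delta> + \<rho>" "\<bar>(z - y) \<bullet> z\<bar> \<le> K" if "z \<in> cball p \<delta>" for z
  proof -
    have zp: "norm (z - p) \<le> \<delta>" using that by (simp add: dist_norm norm_minus_commute)
    show 1: "norm (z - y) \<le> \<delta> + \<rho>"
      using norm_triangle_ineq[of "z - p" "p - y"] zp dpy by simp
    have 2: "norm z \<le> \<delta> + norm p" using norm_triangle_ineq[of "z - p" p] zp by simp
    show "\<bar>(z - y) \<bullet> z\<bar> \<le> K"
      unfolding K_def by (rule order_trans[OF Cauchy_Schwarz_ineq2 mult_mono[OF 1 2]]) (use \<delta> \<rho> in auto)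
  qed
  have "0 \<le> K" using \<delta> \<rho> by (simp add: K_def)
  \<comment> \<open>The leading term \<open>4 * \<alpha> * \<kappa>\<close> then exceeds by 1 the
    worst case \<open>2 * n + K\<close> of the remaining terms in the drift Laplacian of the
    barrier.\<close>
  define \<alpha> where "\<alpha> = (2 * real n + K + 1) / (4 * \<kappa>)"
  have \<alpha>: "\<alpha> > 0" "4 * \<alpha> * \<kappa> = 2 * real n + K + 1" using \<kappa> \<open>0 \<le> K\<close> by (simp_all add: \<alpha>_def add_nonneg_pos)
  define E where "E x = exp (- \<alpha> * ((x - y) \<bullet> (x - y)))" for x
  define h where "h x = E x - exp (- \<alpha> * \<rho>\<^sup>2)" for x
  have dE: "(E has_derivative (\<lambda>d. - 2 * \<alpha> * E x * ((x - y) \<bullet> d))) (at x)" for x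
    unfolding E_def by (auto intro!: derivative_eq_intros simp: inner_commute algebra_simps)
  have E1: "0 < E x" "E x \<le> 1" for x unfolding E_def using \<alpha>(1) by auto
  have h1: "h x < 1" for x 
    unfolding h_def using E1(2)[of x] exp_gt_zero[of "- \<alpha> * \<rho>\<^sup>2"] by linarith
  have hneg: "h x < 0" if "\<rho> < dist x y" for x
  proof -
    have "\<rho>\<^sup>2 < (dist x y)\<^sup>2" using that \<rho> by (intro power_strict_mono) auto
    then show ?thesis unfolding h_def E_def using \<alpha>(1) by (simp add: dist_norm power2_norm_eq_inner)
  qed
  have hp: "h p = 0" unfolding h_def E_def using dpy by (simp add: power2_norm_eq_inner[symmetric])
  \<comment> \<open>On the boundary sphere, points of \<open>S\<close> in the tangent ball are not
    in \<open>T\<close>, so \<open>v\<close> is below \<open>M\<close> there, uniformly by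
    compactness. If there are no such points, any positive \<open>m\<close> serves.\<close>
  obtain m where m: "m > 0" "\<And>x. x \<in> S \<Longrightarrow> dist p x = \<delta> \<Longrightarrow> dist x y \<le> \<rho> \<Longrightarrow> v x \<le> M - m"
  proof (cases "S \<inter> sphere p \<delta> \<inter> cball y \<rho> = {}")
    case True
    show ?thesis
      by (rule that[of 1]) (use True in \<open>auto simp: disjoint_iff dist_commute\<close>)
  next
    case False
    moreover have "compact (S \<inter> sphere p \<delta> \<inter> cball y \<rho>)"
      by (intro compact_Int_closed closed_Int_compact closed_S) auto
    moreover have "continuous_on (S \<inter> sphere p \<delta> \<inter> cball y \<rho>) v"
      by (rule continuous_on_subset[OF cont_v]) (use S_X in auto)
    ultimately obtain q where q: "q \<in> S \<inter> sphere p \<delta> \<inter> cball y \<rho>"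
      "\<And>x. x \<in> S \<inter> sphere p \<delta> \<inter> cball y \<rho> \<Longrightarrow> v x \<le> v q"
      using continuous_attains_sup by metis
    have "v q \<noteq> M"
    proof
      assume "v q = M"
      then have "q \<in> T" using v_eq q(1) by (simp add: T_def)
      then have "q = p" using touch q(1) by (simp add: dist_commute)
      then show False using q(1) \<delta>(1) by simp
    qed
    then have "v q < M" using v_le[of q] q(1) by simp
    then show ?thesis
      by (intro that[of "M - v q"]) (use q(2) in \<open>auto simp: dist_commute\<close>)
  qed
  \<comment> \<open>The first bound keeps \<open>v + \<epsilon> h\<close> below \<open>M\<close> on
    the sphere inside the tangent ball, where \<open>h < 1\<close>; the second keeps its gradient
    within \<open>\<beta> / 2\<close> of \<open>g\<close>.\<close>
  define \<epsilon> where "\<epsilon> = min (m / 2) (\<beta> / (8 * \<alpha> * (\<delta> + \<rho>)))"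
  have \<epsilon>: "\<epsilon> > 0" "\<epsilon> < m" "\<epsilon> * (2 * \<alpha> * (\<delta> + \<rho>)) < \<beta> / 2"
  proof -
    have D: "0 < \<alpha> * (\<delta> + \<rho>)" using \<alpha>(1) \<delta>(1) \<rho> by simp
    then have "0 < \<beta> / (8 * \<alpha> * (\<delta> + \<rho>))" using \<beta>(1) by (simp add: mult.assoc)
    then show "\<epsilon> > 0" using m(1) by (simp add: \<epsilon>_def)
    have "\<epsilon> \<le> m / 2" by (simp add: \<epsilon>_def)
    then show "\<epsilon> < m" using m(1) by simp
    have "\<epsilon> * (2 * \<alpha> * (\<delta> + \<rho>)) \<le> \<beta> / (8 * \<alpha> * (\<delta> + \<rho>)) * (2 * \<alpha> * (\<delta> + \<rho>))"
      using D by (intro mult_right_mono) (auto simp: \<epsilon>_def mult.assoc)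
    also have "\<dots> = \<beta> / 4" using D \<alpha>(1) \<delta>(1) \<rho> by (simp add: field_simps)
    finally show "\<epsilon> * (2 * \<alpha> * (\<delta> + \<rho>)) < \<beta> / 2" using \<beta>(1) by simp
  qed
  \<comment> \<open>At a maximum of \<open>f\<close> the normal is parallel to the gradient of \<open>f\<close>, which is close to that of
    \<open>v\<close>, so the tangent spaces of \<open>S\<close> need not be compared at different points.\<close>
  define f where "f x = v x + \<epsilon> * h x" for x
  have "continuous_on X f"
    unfolding f_def h_def E_def by (intro continuous_intros cont_v)
  then have "continuous_on (S \<inter> cball p \<delta>) f"
    by (rule continuous_on_subset) (use S_X in auto)
  moreover have "compact (S \<inter> cball p \<delta>)" using closed_S by (simp add: closed_Int_compact)
  moreover have pN: "p \<in> S \<inter> cball p \<delta>" using pS(1) \<delta>(1) by simp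
  ultimately obtain z where z: "z \<in> S \<inter> cball p \<delta>" "\<And>x. x \<in> S \<inter> cball p \<delta> \<Longrightarrow> f x \<le> f z"
    using continuous_attains_sup by (metis empty_iff)
  have "f z \<ge> M" using z(2)[OF pN] hp v_C[OF pS(2)] by (simp add: f_def)
  have zin: "z \<in> ball p \<delta>"
  proof (rule ccontr)
    assume "z \<notin> ball p \<delta>"
    then have dz: "dist p z = \<delta>" using z(1) by simp
    have "f z < M"
    proof (cases "dist z y \<le> \<rho>")
      case True
      have "\<epsilon> * h z < \<epsilon> * 1" using h1[of z] \<epsilon>(1) by (intro mult_strict_left_mono) auto
      then show ?thesis using m(2)[OF _ dz True] z(1) \<epsilon>(2) by (simp add: f_def)
    next
      case False
      then have "\<epsilon> * h z < 0" using hneg[of z] \<epsilon>(1) by (simp add: mult_pos_neg)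
      then show ?thesis using v_le[of z] z(1) by (simp add: f_def)
    qed
    with \<open>f z \<ge> M\<close> show False by simp
  qed
  have zS: "z \<in> S" and zc: "z \<in> cball p \<delta>" and zX: "z \<in> X" using z(1) S_X by auto
  have 1: "(f has_derivative (\<lambda>d. (g x + (- 2 * \<alpha> * \<epsilon> * E x) *\<^sub>R (x - y)) \<bullet> d)) (at x)" if "x \<in> ball p \<delta>" for x
  proof -
    have "x \<in> X" using that \<delta>(2) by auto
    then show ?thesis
      unfolding f_def h_def
      by (auto intro!: derivative_eq_intros dv dE simp: inner_add_left inner_diff_left algebra_simps)
  qed
  have 2: "((\<lambda>x. g x + (- 2 * \<alpha> * \<epsilon> * E x) *\<^sub>R (x - y)) has_derivative
     (\<lambda>d. H z d + ((- 2 * \<alpha> * \<epsilon> * E z) *\<^sub>R d + (4 * \<alpha>\<^sup>2 * \<epsilon> * E z * ((z - y) \<bullet> d)) *\<^sub>R (z - y)))) (at z)"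
    by (rule derivative_eq_intros dg[OF zX] dE refl | simp)+
       (simp add: fun_eq_iff power2_eq_square algebra_simps)
  obtain \<nu> c where \<nu>: "norm \<nu> = 1" "g z + (- 2 * \<alpha> * \<epsilon> * E z) *\<^sub>R (z - y) = c *\<^sub>R \<nu>"
    "(\<Sum>b\<in>Basis. (H z b + ((- 2 * \<alpha> * \<epsilon> * E z) *\<^sub>R b + (4 * \<alpha>\<^sup>2 * \<epsilon> * E z * ((z - y) \<bullet> b)) *\<^sub>R (z - y))) \<bullet> b)
     - (H z \<nu> + ((- 2 * \<alpha> * \<epsilon> * E z) *\<^sub>R \<nu> + (4 * \<alpha>\<^sup>2 * \<epsilon> * E z * ((z - y) \<bullet> \<nu>)) *\<^sub>R (z - y))) \<bullet> \<nu>
     - (g z + (- 2 * \<alpha> * \<epsilon> * E z) *\<^sub>R (z - y)) \<bullet> z / 2 \<le> 0"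
    by (rule shrinker_maximum_principle[OF dim shrinker zS open_ball zin _ 1 2]) (use z(2) in auto)
  have "norm (c *\<^sub>R \<nu> - g z) = 2 * \<alpha> * \<epsilon> * E z * norm (z - y)"
    unfolding \<nu>(2)[symmetric] using \<alpha>(1) \<epsilon>(1) E1(1)[of z] by (simp add: abs_mult)
  also have "\<dots> \<le> 2 * \<alpha> * \<epsilon> * 1 * (\<delta> + \<rho>)"
    using \<alpha>(1) \<epsilon>(1) E1[of z] near(1)[OF zc] \<delta>(1) \<rho> by (intro mult_mono) auto
  also have "\<dots> < \<beta> / 2" using \<epsilon>(3) by (simp add: mult.commute mult.left_commute)
  finally have "\<kappa> \<le> (norm (z - y))\<^sup>2 - ((z - y) \<bullet> \<nu>)\<^sup>2"
    using not_normal_near[OF zc _ \<nu>(1)] by blast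
  then have "4 * \<alpha> * \<kappa> \<le> 4 * \<alpha> * ((norm (z - y))\<^sup>2 - ((z - y) \<bullet> \<nu>)\<^sup>2)" using \<alpha>(1) by simp
  then have hL: "0 < 4 * \<alpha> * ((norm (z - y))\<^sup>2 - ((z - y) \<bullet> \<nu>)\<^sup>2) - 2 * real n + (z - y) \<bullet> z"
    using \<alpha>(2) near(2)[OF zc] by linarith
  have "\<nu> \<bullet> \<nu> = 1" using \<nu>(1) by (simp add: norm_eq_1)
  then have "(\<Sum>b\<in>Basis. H z b \<bullet> b) - H z \<nu> \<bullet> \<nu> - g z \<bullet> z / 2
      + \<epsilon> * E z * \<alpha> * (4 * \<alpha> * ((norm (z - y))\<^sup>2 - ((z - y) \<bullet> \<nu>)\<^sup>2) - 2 * real n + (z - y) \<bullet> z) \<le> 0"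
    using \<nu>(3)[unfolded trace_rank_one] by (simp add: dim inner_add_left power2_eq_square algebra_simps diff_divide_distrib add_divide_distrib)
  moreover have "0 < \<epsilon> * E z * \<alpha> * (4 * \<alpha> * ((norm (z - y))\<^sup>2 - ((z - y) \<bullet> \<nu>)\<^sup>2) - 2 * real n + (z - y) \<bullet> z)"
    using hL \<epsilon>(1) E1(1)[of z] \<alpha>(1) by simp
  ultimately show False
    using drift[OF zS \<nu>(1)] \<theta>_nonneg[OF zS] by linarith
qed

text \<open>The proof applies invariance of domain to \<open>x \<mapsto> \<phi> (\<pi> x) + (v x - M) l\<close>, with \<open>\<phi>\<close> a slice chart of \<open>S\<close>
  and \<open>l\<close> a unit normal of the slice.\<close>

lemma C_open_in_S:
  assumes "p \<in> C"
  obtains Y where "open Y" "p \<in> Y" "S \<inter> Y \<subseteq> C"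
proof -
  have pS: "p \<in> S" "p \<in> Z" using assms C_subset_S C_Z by auto
  obtain U V \<phi> \<psi> L where "slice_chart S U V L \<phi> \<psi>" and pU: "p \<in> U" and dimL: "dim L = n"
    using shrinker pS(1) unfolding shrinker_def submanifold_def slice_chart_def by metis
  then interpret slice_chart S U V L \<phi> \<psi> by simp
  obtain l0 where l0: "l0 \<noteq> 0" "\<And>x. x \<in> span L \<Longrightarrow> orthogonal l0 x"
    using orthogonal_to_subspace_exists[of L] dimL dim by auto
  define l where "l = l0 /\<^sub>R norm l0"
  have l: "l \<bullet> l = 1" "\<And>x. x \<in> L \<Longrightarrow> x \<bullet> l = 0"
    using l0 span_base[of _ L]
    by (auto simp: l_def orthogonal_def inner_commute field_simps dot_square_norm power2_eq_square)
  define N where "N = Z \<inter> \<pi> -` U"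
  define F where "F x = \<phi> (\<pi> x) + (v x - M) *\<^sub>R l" for x
  have "open N" unfolding N_def by (rule continuous_open_preimage[OF cont_\<pi> open_Z open_U])
  have \<pi>L: "\<phi> (\<pi> x) \<in> L" if "x \<in> N" for x
    using that \<pi>_C C_subset_S chart_slice[of "\<pi> x"] by (auto simp: N_def)
  have Fl: "F x \<bullet> l = v x - M" if "x \<in> N" for x
    unfolding F_def using l(2)[OF \<pi>L[OF that]] l(1) by (simp add: inner_add_left)
  have "inj_on F N"
  proof (rule inj_onI)
    fix x x' assume x: "x \<in> N" "x' \<in> N" "F x = F x'"
    then have "v x = v x'" using Fl by (metis diff_add_cancel)
    moreover have "\<phi> (\<pi> x) = \<phi> (\<pi> x')" using x(3) calculation by (simp add: F_def)
    then have "\<pi> x = \<pi> x'" using x(1,2) inv_chart by (metis IntD2 N_def vimageE)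
    ultimately show "x = x'" using inj_onD[OF inj_\<pi>, of x x'] x(1,2) by (simp add: N_def)
  qed
  moreover have "continuous_on N F"
  proof -
    have "continuous_on N \<pi>" "continuous_on N v"
      using Z_X by (auto intro: continuous_on_subset[OF cont_\<pi>] continuous_on_subset[OF cont_v] simp: N_def)
    moreover have "continuous_on U \<phi>" using homeo by (simp add: homeomorphism_def)
    moreover from calculation have "continuous_on N (\<lambda>x. \<phi> (\<pi> x))"
      using continuous_on_compose2[of U \<phi> N \<pi>] by (auto simp: N_def)
    ultimately show ?thesis unfolding F_def by (intro continuous_intros)
  qed
  ultimately have "open (F ` N)" using invariance_of_domain \<open>open N\<close> by blast
  then have "open (U \<inter> \<phi> -` (F ` N))"
    using homeo open_U by (intro continuous_open_preimage) (auto simp: homeomorphism_def)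
  moreover have "p \<in> U \<inter> \<phi> -` (F ` N)"
  proof -
    have "p \<in> N" "F p = \<phi> p" using pS pU assms \<pi>_id v_C by (auto simp: N_def F_def)
    then show ?thesis using pU by (metis IntI imageI vimageI)
  qed
  moreover have "S \<inter> (U \<inter> \<phi> -` (F ` N)) \<subseteq> C"
  proof
    fix q assume q: "q \<in> S \<inter> (U \<inter> \<phi> -` (F ` N))"
    then obtain x where x: "x \<in> N" "\<phi> q = F x" by auto
    \<comment> \<open>The component of \<open>F x\<close> along \<open>l\<close> is
      \<open>v x - M\<close>; it vanishes because \<open>\<phi> q\<close> lies in the slice, which
      leaves only the image of a point of \<open>C\<close>.\<close>
    have "\<phi> q \<in> L" using q chart_slice by blast
    then have "v x - M = 0" using l(2) Fl[OF x(1)] x(2) by metis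
    then have "\<phi> q = \<phi> (\<pi> x)" using x(2) by (simp add: F_def)
    then have "q = \<pi> x" using q x(1) inv_chart by (metis IntD1 IntD2 N_def vimageE)
    then show "q \<in> C" using \<pi>_C x(1) by (auto simp: N_def)
  qed
  ultimately show ?thesis using that by blast
qed

text \<open>The open sets from \<open>C_open_in_S\<close> cover \<open>C\<close> and meet
  \<open>S\<close> only in \<open>C\<close>, so \<open>S - C\<close> is closed. It is also
  relatively open, and by \<open>touches\<close> it would meet \<open>C\<close> if it were
  nonempty.\<close>

lemma S_eq_C: "S = C"
proof -
  define Y where "Y = \<Union>{Y. open Y \<and> S \<inter> Y \<subseteq> C}"
  have Y: "open Y" "S \<inter> Y \<subseteq> C" by (auto simp: Y_def)
  have "C \<subseteq> Y" using C_open_in_S unfolding Y_def by blast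
  then have eq: "S - C = S - Y" using Y(2) by blast
  have "closed (S - C)" unfolding eq using closed_S Y(1) by (simp add: closed_Diff)
  then have "S - C = {}"
    using touches[of "S - C" "- C"] closed_C by blast
  then show ?thesis using C_subset_S by blast
qed

end


subsection \<open>Generalized cylinders\<close>

text \<open>Points of \<open>S\<close> where \<open>f\<close> has opposite signs would lie in one
  component of the complement, and connectedness would produce a zero of \<open>f\<close> there.
  One-sidedness thus becomes a sign condition without determining the components.\<close>

lemma on_one_side_cases:
  fixes f :: "'a::euclidean_space \<Rightarrow> real"
  assumes side: "on_one_side S C" and f: "continuous_on UNIV f" "\<And>x. x \<in> C \<longleftrightarrow> f x = 0"
  shows "(\<forall>x\<in>S. f x \<le> 0) \<or> (\<forall>x\<in>S. 0 \<le> f x)"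
proof (rule ccontr)
  assume "\<not> ?thesis"
  then obtain a b where ab: "a \<in> S" "f a > 0" "b \<in> S" "f b < 0" by (auto simp: not_le)
  let ?K = "connected_component_set (- C)"
  have "a \<in> - C" "b \<in> - C" using f(2) ab by auto
  then have "?K a \<in> components (- C)" "?K b \<in> components (- C)" "a \<in> ?K a" "b \<in> ?K b"
    by (simp_all add: componentsI)
  moreover from calculation have "S \<inter> ?K a \<noteq> {}" "S \<inter> ?K b \<noteq> {}" using ab(1,3) by blast+
  ultimately have "?K a = ?K b"
    using side unfolding on_one_side_def by meson
  then have "a \<in> ?K a" "b \<in> ?K a"
    using \<open>a \<in> ?K a\<close> \<open>b \<in> ?K b\<close> by simp_all
  moreover have "connected (f ` ?K a)"
    by (rule connected_continuous_image[OF continuous_on_subset[OF f(1)]]) auto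
  ultimately have "0 \<in> f ` ?K a"
    using connectedD_interval[of "f ` ?K a" "f b" "f a" 0] ab(2,4) by simp
  then obtain q where q: "q \<in> ?K a" "f q = 0" by (metis imageE)
  have "q \<in> - C" using subsetD[OF connected_component_subset q(1)] .
  then show False using f(2)[of q] q(2) by simp
qed

lemma orthogonal_projection:
  fixes W :: "'a::euclidean_space set"
  assumes "subspace W"
  obtains P :: "'a \<Rightarrow> 'a" where "bounded_linear P" "\<And>x. P x \<in> W" "\<And>x. x - P x \<in> orthogonal_comp W"
    "(\<Sum>b\<in>Basis. P b \<bullet> b) = dim W"
proof -
  obtain B where B: "B \<subseteq> W" "pairwise orthogonal B" "\<And>x. x \<in> B \<Longrightarrow> norm x = 1"
    "independent B" "card B = dim W" "span B = W"
    using orthonormal_basis_subspace[OF assms] by metis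
  have fin: "finite B" using B(4) independent_imp_finite by blast
  define P where "P x = (\<Sum>b\<in>B. (x \<bullet> b) *\<^sub>R b)" for x
  have idem: "P x = x" if "x \<in> W" for x
    unfolding P_def using orthonormal_basis_expand[OF B(2,3) _ fin] B(6) that by simp
  have Pb: "P x \<bullet> b = x \<bullet> b" if "b \<in> B" for x b
  proof -
    have "P x \<bullet> b = (\<Sum>c\<in>B. (x \<bullet> c) * (c \<bullet> b))" by (simp add: P_def inner_sum_left)
    also have "\<dots> = x \<bullet> (\<Sum>c\<in>B. (b \<bullet> c) *\<^sub>R c)" by (simp add: inner_sum_right inner_commute[of b] mult.commute)
    also have "\<dots> = x \<bullet> b" using idem[of b] B(1) that by (auto simp: P_def)
    finally show ?thesis .
  qed
  have "bounded_linear P"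
    unfolding P_def
    by (intro bounded_linear_sum bounded_linear_compose[OF bounded_linear_scaleR_left bounded_linear_inner_left])
  moreover have "P x \<in> W" for x
    unfolding P_def using B(1) assms by (intro subspace_sum subspace_scale) auto
  moreover have "x - P x \<in> orthogonal_comp W" for x
  proof -
    have "(x - P x) \<bullet> y = 0" if "y \<in> W" for y
    proof -
      have "(x - P x) \<bullet> P y = 0"
        by (simp add: P_def[of y] inner_sum_right inner_diff_left Pb)
      then show ?thesis using idem[OF that] by simp
    qed
    then show ?thesis by (auto simp: orthogonal_comp_def orthogonal_def inner_commute)
  qed
  moreover have "(\<Sum>b\<in>Basis. P b \<bullet> b) = dim W"
  proof -
    have "(\<Sum>i\<in>Basis. P i \<bullet> i) = (\<Sum>b\<in>B. \<Sum>i\<in>Basis. (b \<bullet> i) * (b \<bullet> i))"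
      unfolding P_def inner_sum_left by (subst sum.swap) (simp add: inner_commute)
    also have "\<dots> = (\<Sum>b\<in>B. 1)"
      using B(3) by (intro sum.cong refl) (simp flip: euclidean_inner add: norm_eq_1)
    finally show ?thesis using B(5) by simp
  qed
  ultimately show ?thesis using that by blast
qed

locale cylinder =
  fixes W :: "'a::euclidean_space set" and k :: nat and P :: "'a \<Rightarrow> 'a"
  assumes W: "subspace W" "dim W = k + 1"
    and P: "bounded_linear P" "P x \<in> W" "x - P x \<in> orthogonal_comp W"
    and trace_P: "(\<Sum>b\<in>Basis. P b \<bullet> b) = dim W"
begin

abbreviation C where "C \<equiv> generalized_cylinder k W"

section \<open>Orthogonal projection and topology of the cylinder\<close>

lemma inner_P: "P x \<bullet> y = P x \<bullet> P y"
  using P(2)[of x] P(3)[of y] by (auto simp: orthogonal_comp_def orthogonal_def inner_diff_right)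

lemma inner_P': "x \<bullet> P y = P x \<bullet> P y"
  using inner_P[of y x] by (simp add: inner_commute)

lemma inner_P_P: "P x \<bullet> P d = P x \<bullet> d" "P d \<bullet> P x = P x \<bullet> d"
  using inner_P by (metis, metis inner_commute)

lemma P_unique:
  assumes "u \<in> W" "w \<in> orthogonal_comp W"
  shows "P (u + w) = u"
proof -
  let ?d = "P (u + w) - u"
  have 1: "?d \<in> W" using assms W P(2) by (simp add: subspace_diff)
  have "w - (u + w - P (u + w)) \<in> orthogonal_comp W"
    by (rule subspace_diff[OF subspace_orthogonal_comp assms(2) P(3)])
  then have "?d \<in> orthogonal_comp W" by (simp add: algebra_simps)
  then show ?thesis using 1 by (auto simp: orthogonal_comp_def orthogonal_def)
qed

lemma C_iff: "x \<in> C \<longleftrightarrow> norm (P x) = sqrt (2 * real k)"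
proof
  assume "x \<in> C"
  then show "norm (P x) = sqrt (2 * real k)"
    using P_unique unfolding generalized_cylinder_def by auto
next
  assume "norm (P x) = sqrt (2 * real k)"
  then show "x \<in> C"
    using P(2,3)[of x] unfolding generalized_cylinder_def
    by (intro CollectI exI[of _ "P x"] exI[of _ "x - P x"]) auto
qed

lemma C_iff': "x \<in> C \<longleftrightarrow> P x \<bullet> P x = 2 * real k"
  unfolding C_iff norm_eq_sqrt_inner by simp

lemma cont_P: "continuous_on A P"
  by (rule bounded_linear.continuous_on[OF P(1) continuous_on_id])

lemma closed_C: "closed C"
proof -
  have "C = P -` sphere 0 (sqrt (2 * real k))" by (simp add: set_eq_iff C_iff)
  also have "closed \<dots>" by (rule closed_vimage[OF closed_sphere cont_P])
  finally show ?thesis .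
qed

text \<open>The cylinder is the continuous image, under addition, of a sphere in \<open>W\<close>
  times a subspace. For \<open>k > 0\<close> the sphere bounds a ball of dimension at least 2; for
  \<open>k = 0\<close> it is the single point 0.\<close>

lemma connected_C: "connected C"
proof -
  have "connected (sphere 0 (sqrt (2 * real k)) \<inter> W)"
  proof (cases "k = 0")
    case True
    then show ?thesis using subspace_0[OF W(1)] by simp
  next
    case False
    let ?B = "cball (0 :: 'a) (sqrt (2 * real k))"
    have pos: "0 < sqrt (2 * real k)" using False by simp
    then have "0 \<in> interior ?B \<inter> W" using subspace_0[OF W(1)] by simp
    then have ne: "interior ?B \<inter> W \<noteq> {}" by blast
    have aff: "affine W" using W(1) subspace_imp_affine by blast
    have "rel_frontier (?B \<inter> W) = sphere 0 (sqrt (2 * real k)) \<inter> W"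
      using convex_affine_rel_frontier_Int[OF convex_cball aff ne] pos by simp
    moreover have "aff_dim (?B \<inter> W) = int (k + 1)"
      using aff_dim_convex_Int_nonempty_interior[of W ?B] aff_dim_subspace[OF W(1)] W ne
      by (simp add: Int_commute subspace_imp_convex)
    then have "connected (rel_frontier (?B \<inter> W))"
      using False W(1) by (intro connected_sphere_gen convex_Int bounded_Int)
        (auto simp: subspace_imp_convex)
    ultimately show ?thesis by simp
  qed
  moreover have "connected (orthogonal_comp W)"
    by (intro convex_connected subspace_imp_convex subspace_orthogonal_comp)
  ultimately have "connected ((\<lambda>(u, w). u + w) `
      ((sphere 0 (sqrt (2 * real k)) \<inter> W) \<times> orthogonal_comp W))"
    by (intro connected_continuous_image connected_Times)
       (auto simp: case_prod_unfold intro!: continuous_intros)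
  moreover have "(\<lambda>(u, w). u + w) ` ((sphere 0 (sqrt (2 * real k)) \<inter> W) \<times> orthogonal_comp W) = C"
    unfolding generalized_cylinder_def by force
  ultimately show ?thesis by simp
qed

lemma hyperplane_shrinker_eq:
  assumes "k = 0" "DIM('a) = n + 1" "shrinker n S" "closed S" "on_one_side S C"
  shows "S = C"
proof -
  obtain w0 where w0: "w0 \<in> W" "norm w0 = 1" "span {w0} = W"
  proof -
    obtain B where B: "B \<subseteq> W" "\<And>x. x \<in> B \<Longrightarrow> norm x = 1" "card B = dim W" "span B = W"
      using orthonormal_basis_subspace[OF W(1)] by metis
    then obtain w where "B = {w}" using W(2) assms(1) by (auto simp: card_1_singleton_iff)
    then show ?thesis using that B by auto
  qed
  have C0: "x \<in> C \<longleftrightarrow> x \<bullet> w0 = 0" for x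
  proof -
    have "P x \<bullet> P x = 0 \<longleftrightarrow> x \<bullet> w0 = 0"
    proof
      assume "P x \<bullet> P x = 0"
      then show "x \<bullet> w0 = 0" using P(3)[of x] w0(1)
        by (auto simp: orthogonal_comp_def orthogonal_def inner_commute)
    next
      assume x: "x \<bullet> w0 = 0"
      obtain c where c: "P x = c *\<^sub>R w0" using P(2)[of x] w0(3) by (auto simp: span_singleton)
      have "P x \<bullet> P x = x \<bullet> P x" using inner_P' by simp
      then show "P x \<bullet> P x = 0" using x c by simp
    qed
    then show ?thesis using C_iff' assms(1) by simp
  qed
  have "(\<forall>x\<in>S. x \<bullet> w0 \<le> 0) \<or> (\<forall>x\<in>S. 0 \<le> x \<bullet> w0)"
    by (rule on_one_side_cases[OF assms(5) _ C0]) (intro continuous_intros)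
  then obtain w where w: "norm w = 1" "\<And>x. x \<in> C \<longleftrightarrow> x \<bullet> w = 0" "\<And>x. x \<in> S \<Longrightarrow> x \<bullet> w \<le> 0"
  proof
    assume "\<forall>x\<in>S. x \<bullet> w0 \<le> 0"
    then show ?thesis using that[of w0] w0(2) C0 by blast
  next
    assume "\<forall>x\<in>S. 0 \<le> x \<bullet> w0"
    then show ?thesis using that[of "- w0"] w0(2) C0 by simp
  qed
  have ww: "w \<bullet> w = 1" using w(1) by (simp add: norm_eq_1)
  \<comment> \<open>The Hessian vanishes, so the drift Laplacian is just
    \<open>- (x \<bullet> w) / 2\<close>. Chords of a hyperplane are orthogonal to \<open>w\<close>
    at every length, hence the arbitrary \<open>r = 1\<close>.\<close>
  interpret comparison S C UNIV UNIV n "\<lambda>x. x \<bullet> w" "\<lambda>x. w" "\<lambda>x d. 0" "\<lambda>x. - (x \<bullet> w) / 2" 0 1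
    "\<lambda>x. x - (x \<bullet> w) *\<^sub>R w"
  proof
    show "((\<lambda>x. x \<bullet> w) has_derivative (\<lambda>d. w \<bullet> d)) (at x)" for x
      by (auto intro!: derivative_eq_intros simp: inner_commute)
    show "((p - y) \<bullet> w)\<^sup>2 < (norm (p - y))\<^sup>2 * (norm w)\<^sup>2" if "p \<in> C" "y \<in> C" "p \<noteq> y" for p y
      using that w(1,2) by (simp add: inner_diff_left)
    show "inj_on (\<lambda>x. (x - (x \<bullet> w) *\<^sub>R w, x \<bullet> w)) UNIV"
      by (rule inj_onI) auto
    show "- (x \<bullet> w) / 2 \<le> (\<Sum>b\<in>(Basis :: 'a set). 0 \<bullet> b) - 0 \<bullet> \<nu> - w \<bullet> x / 2" for x \<nu> :: 'a
      by (simp add: inner_commute)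
    show "(\<lambda>x. x - (x \<bullet> w) *\<^sub>R w) ` UNIV \<subseteq> C"
    proof (rule image_subsetI)
      show "x - (x \<bullet> w) *\<^sub>R w \<in> C" for x
        unfolding w(2) by (simp add: inner_diff_left ww)
    qed
    show "continuous_on UNIV (\<lambda>x. x - (x \<bullet> w) *\<^sub>R w)" "continuous_on S (\<lambda>x. - (x \<bullet> w) / 2)"
      by (intro continuous_intros; simp)+
    show "closed C" "connected C" by (rule closed_C connected_C)+
  qed (use assms(2-4) w in simp_all)
  show ?thesis by (rule S_eq_C)
qed

section \<open>The radial retraction and the cases of positive \<open>k\<close>\<close>

abbreviation R where "R \<equiv> sqrt (2 * real k)"
text \<open>For \<open>k > 0\<close> and off the axis this is the nearest-point retraction to the
  cylinder; it serves as \<pi> in \<open>comparison\<close>.\<close>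

abbreviation radial where "radial x \<equiv> x - P x + (R / norm (P x)) *\<^sub>R P x"

lemma P_scale: "P (c *\<^sub>R x) = c *\<^sub>R P x" and P_add: "P (x + y) = P x + P y"
  and P_diff: "P (x - y) = P x - P y"
  using P(1) by (simp_all add: bounded_linear.linear linear_cmul linear_add linear_diff)

lemma P_P: "P (P x) = P x"
  using P_unique[OF P(2) subspace_0[OF subspace_orthogonal_comp], of x] by simp

lemma P_radial: "P (radial x) = (R / norm (P x)) *\<^sub>R P x"
  by (simp add: P_add P_diff P_scale P_P)

lemma radial_in_C: "P x \<noteq> 0 \<Longrightarrow> radial x \<in> C"
  by (simp add: C_iff P_radial)

text \<open>Since \<open>P p\<close> and \<open>P y\<close> have equal length, the chord pairs with
  \<open>P p\<close> to half of |P (p - y)|^2, at most half the squared chord length; a normal chord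
  would need the chord length times \<open>R\<close>.\<close>

lemma not_radial:
  assumes "p \<in> C" "y \<in> C" "p \<noteq> y" "dist p y < R"
  shows "((p - y) \<bullet> P p)\<^sup>2 < (norm (p - y))\<^sup>2 * (norm (P p))\<^sup>2"
proof -
  define u where "u = P (p - y)"
  define d where "d = norm (p - y)"
  have d: "0 < d" "d < R" using assms(3,4) by (auto simp: d_def dist_norm)
  have "(norm u)\<^sup>2 = u \<bullet> (p - y)" unfolding u_def power2_norm_eq_inner by (rule inner_P[symmetric])
  also have "\<dots> \<le> norm u * d" unfolding d_def by (rule norm_cauchy_schwarz)
  finally have ud: "norm u \<le> d" using d(1) by (cases "u = 0") (auto simp: power2_eq_square)
  have "2 * ((p - y) \<bullet> P p) = u \<bullet> u + P p \<bullet> P p - P y \<bullet> P y"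
    unfolding u_def P_diff inner_P'[of "p - y" p]
    by (simp add: inner_diff_left inner_diff_right inner_commute)
  also have "\<dots> = u \<bullet> u" using assms(1,2) C_iff' by simp
  finally have half: "(p - y) \<bullet> P p = (norm u)\<^sup>2 / 2" by (simp add: power2_norm_eq_inner)
  have "\<bar>(p - y) \<bullet> P p\<bar> \<le> d\<^sup>2 / 2"
    unfolding half using power_mono[OF ud norm_ge_zero, of 2] by simp
  also have "\<dots> < d * R"
    using mult_strict_left_mono[OF d(2,1)] d by (simp add: power2_eq_square)
  finally have "\<bar>(p - y) \<bullet> P p\<bar>\<^sup>2 < (d * R)\<^sup>2"
    by (intro power_strict_mono) auto
  then show ?thesis using assms(1) C_iff by (simp add: power_mult_distrib d_def)
qed

lemma cont_radial: "continuous_on {x. P x \<noteq> 0} radial"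
  by (intro continuous_intros cont_P) auto

lemma open_P_nonzero: "open {x. P x \<noteq> 0}"
proof -
  have "{x. P x \<noteq> 0} = P -` (- {0})" by auto
  moreover have "open (P -` (- {0}))" by (rule open_vimage) (auto intro: cont_P)
  ultimately show ?thesis by simp
qed

lemma radial_inj:
  assumes "k > 0" "P x \<noteq> 0" "P y \<noteq> 0" "radial x = radial y" "norm (P x) = norm (P y)"
  shows "x = y"
proof -
  have "(R / norm (P x)) *\<^sub>R P x = (R / norm (P x)) *\<^sub>R P y"
  proof -
    have "(R / norm (P x)) *\<^sub>R P x = (R / norm (P y)) *\<^sub>R P y"
      using arg_cong[OF assms(4), of P] unfolding P_radial .
    then show ?thesis unfolding assms(5) .
  qed
  moreover have "R / norm (P x) \<noteq> 0" using assms(1,2) by simp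
  ultimately have "P x = P y" by (metis scaleR_cancel_left)
  then show ?thesis using assms(4) by simp
qed

lemma C_P_nonzero: "k > 0 \<Longrightarrow> x \<in> C \<Longrightarrow> P x \<noteq> 0"
  using C_iff by auto

lemma radial_id: "k > 0 \<Longrightarrow> x \<in> C \<Longrightarrow> radial x = x"
  using C_iff[of x] by simp

text \<open>The left side is |P \<nu>|^2. Thus the normal direction removes at most 1 from the trace
  \<open>k + 1\<close> of \<open>P\<close>.\<close>

lemma P_inner_le: "norm \<nu> = 1 \<Longrightarrow> P \<nu> \<bullet> \<nu> \<le> 1"
proof -
  assume \<nu>: "norm \<nu> = 1"
  have "(norm (P \<nu>))\<^sup>2 = P \<nu> \<bullet> \<nu>" unfolding power2_norm_eq_inner by (rule inner_P[symmetric])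
  moreover have "\<dots> \<le> norm (P \<nu>)" using norm_cauchy_schwarz[of "P \<nu>" \<nu>] \<nu> by simp
  ultimately have "norm (P \<nu>) * norm (P \<nu>) \<le> norm (P \<nu>)" by (simp add: power2_eq_square)
  then have "norm (P \<nu>) \<le> 1" by (cases "P \<nu> = 0") (auto simp: mult_le_cancel_left2)
  then show ?thesis using norm_cauchy_schwarz[of "P \<nu>" \<nu>] \<nu> by simp
qed

text \<open>With u = P x, the drift Laplacian of |u|^2 is 2 (k + 1) - 2 |P \<nu>|^2 - |u|^2, which
  is at least 2 k - |u|^2. This is \<theta>, nonnegative inside and zero exactly on the
  cylinder.\<close>

lemma inside_shrinker_eq:
  assumes k: "k > 0" and S: "DIM('a) = n + 1" "shrinker n S" "closed S"
    and inside: "\<And>x. x \<in> S \<Longrightarrow> P x \<bullet> P x \<le> 2 * real k"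
  shows "S = C"
proof -
  interpret comparison S C UNIV "{x. P x \<noteq> 0}" n "\<lambda>x. P x \<bullet> P x" "\<lambda>x. 2 *\<^sub>R P x" "\<lambda>x d. 2 *\<^sub>R P d"
    "\<lambda>x. 2 * real k - P x \<bullet> P x" "2 * real k" R radial
  proof
    show "((\<lambda>x. P x \<bullet> P x) has_derivative (\<lambda>d. (2 *\<^sub>R P x) \<bullet> d)) (at x)" for x
      by (auto intro!: derivative_eq_intros bounded_linear.has_derivative[OF P(1)]
          simp: inner_P_P(1)[of x] inner_P_P(2)[of _ x])
    show "((\<lambda>x. 2 *\<^sub>R P x) has_derivative (\<lambda>d. 2 *\<^sub>R P d)) (at x)" for x
      by (auto intro!: derivative_eq_intros bounded_linear.has_derivative[OF P(1)])
    show "2 * real k - P x \<bullet> P x \<le> (\<Sum>b\<in>Basis. (2 *\<^sub>R P b) \<bullet> b) - (2 *\<^sub>R P \<nu>) \<bullet> \<nu> - (2 *\<^sub>R P x) \<bullet> x / 2"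
      if "norm \<nu> = 1" for x \<nu>
      using P_inner_le[OF that] trace_P W(2) by (simp add: inner_P[of x x] flip: sum_distrib_left)
    show "((p - y) \<bullet> 2 *\<^sub>R P p)\<^sup>2 < (norm (p - y))\<^sup>2 * (norm (2 *\<^sub>R P p))\<^sup>2"
      if "p \<in> C" "y \<in> C" "p \<noteq> y" "dist p y < R" for p y
      using not_radial[OF that] by (simp add: power_mult_distrib)
    show "inj_on (\<lambda>x. (radial x, P x \<bullet> P x)) {x. P x \<noteq> 0}"
      using radial_inj[OF k] by (intro inj_onI) (auto simp: norm_eq_sqrt_inner)
  qed (use S k inside closed_C connected_C C_iff' open_P_nonzero cont_radial radial_in_C radial_id
      C_P_nonzero cont_P in \<open>auto intro!: continuous_intros\<close>)
  show ?thesis by (rule S_eq_C)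
qed

text \<open>With -|u|^2 the normal term could only be dropped, leaving the bound |u|^2 - 2 k - 2,
  which is negative near the cylinder. For -|u|, which is concave, the full trace of the Hessian is
  -k / |u| and dropping the normal term loses nothing essential. The domain excludes the axis, where
  |u| is not differentiable and which \<open>S\<close> avoids.\<close>

lemma outside_shrinker_eq:
  assumes k: "k > 0" and S: "DIM('a) = n + 1" "shrinker n S" "closed S"
    and outside: "\<And>x. x \<in> S \<Longrightarrow> 2 * real k \<le> P x \<bullet> P x"
  shows "S = C"
proof -
  have nz: "P x \<noteq> 0" if "x \<in> S" for x using outside[OF that] k by auto
  let ?H = "\<lambda>x d. ((P x \<bullet> d) / norm (P x) ^ 3) *\<^sub>R P x - (1 / norm (P x)) *\<^sub>R P d"
  interpret comparison S C "{x. P x \<noteq> 0}" "{x. P x \<noteq> 0}" n "\<lambda>x. - norm (P x)"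
    "\<lambda>x. - (1 / norm (P x)) *\<^sub>R P x" ?H
    "\<lambda>x. (P x \<bullet> P x - 2 * real k) / (2 * norm (P x))" "- R" R radial
  proof
    show "((\<lambda>x. - norm (P x)) has_derivative (\<lambda>d. (- (1 / norm (P x)) *\<^sub>R P x) \<bullet> d)) (at x)"
      if "x \<in> {x. P x \<noteq> 0}" for x
    proof -
      have "((\<lambda>x. norm (P x)) has_derivative (\<lambda>d. P d \<bullet> sgn (P x))) (at x)"
        using that has_derivative_compose[OF bounded_linear.has_derivative[OF P(1) has_derivative_ident]
            has_derivative_norm[of "P x"]] by simp
      then have "((\<lambda>x. - norm (P x)) has_derivative (\<lambda>d. - (P d \<bullet> sgn (P x)))) (at x)"
        by (rule has_derivative_minus)
      then show ?thesis
        by (rule has_derivative_eq_rhs) (simp add: fun_eq_iff sgn_div_norm inner_P_P(1)[of x] inner_P_P(2)[of _ x] field_simps)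
    qed
    show "((\<lambda>x. - (1 / norm (P x)) *\<^sub>R P x) has_derivative ?H x) (at x)"
      if "x \<in> {x. P x \<noteq> 0}" for x
    proof -
      have n: "((\<lambda>x. norm (P x)) has_derivative (\<lambda>d. P d \<bullet> sgn (P x))) (at x)"
        using that has_derivative_compose[OF bounded_linear.has_derivative[OF P(1) has_derivative_ident]
            has_derivative_norm[of "P x"]] by simp
      have nz: "norm (P x) \<noteq> 0" using that by simp
      have "((\<lambda>x. - inverse (norm (P x))) has_derivative
        (\<lambda>d. - (- (inverse (norm (P x)) * (P d \<bullet> sgn (P x)) * inverse (norm (P x)))))) (at x)"
        by (intro has_derivative_minus Deriv.has_derivative_inverse[OF nz n])
      from has_derivative_scaleR[OF this bounded_linear.has_derivative[OF P(1) has_derivative_ident]]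
      have "((\<lambda>x. - inverse (norm (P x)) *\<^sub>R P x) has_derivative
        (\<lambda>d. - inverse (norm (P x)) *\<^sub>R P d
          + - (- (inverse (norm (P x)) * (P d \<bullet> sgn (P x)) * inverse (norm (P x)))) *\<^sub>R P x)) (at x)" .
      then show ?thesis
        unfolding inverse_eq_divide
        by (rule has_derivative_eq_rhs)
           (simp add: fun_eq_iff sgn_div_norm inner_P_P(1)[of x] inner_P_P(2)[of _ x] power3_eq_cube divide_simps)
    qed
    show "(P x \<bullet> P x - 2 * real k) / (2 * norm (P x)) \<le> (\<Sum>b\<in>Basis. ?H x b \<bullet> b) - ?H x \<nu> \<bullet> \<nu>
        - (- (1 / norm (P x)) *\<^sub>R P x) \<bullet> x / 2" if "x \<in> S" "norm \<nu> = 1" for x \<nu>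
    proof -
      define \<rho> where "\<rho> = norm (P x)"
      have \<rho>: "\<rho> > 0" using nz[OF that(1)] by (simp add: \<rho>_def)
      have uu: "P x \<bullet> P x = \<rho>\<^sup>2" by (simp add: \<rho>_def power2_norm_eq_inner)
      have "(\<Sum>b\<in>Basis. (P x \<bullet> b) * (P x \<bullet> b)) = \<rho>\<^sup>2" by (simp add: uu flip: euclidean_inner)
      then have tr: "(\<Sum>b\<in>Basis. ?H x b \<bullet> b) = \<rho>\<^sup>2 / \<rho> ^ 3 - (real k + 1) / \<rho>"
        using trace_P W(2)
        by (simp add: inner_diff_left sum_subtractf \<rho>_def flip: sum_divide_distrib)
      \<comment> \<open>Cauchy-Schwarz for \<open>P x\<close> and \<open>P \<nu>\<close>; it says
        that the Hessian of -|u| is nonpositive in the direction \<nu>.\<close>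
      have "(P x \<bullet> \<nu>)\<^sup>2 \<le> \<rho>\<^sup>2 * (P \<nu> \<bullet> \<nu>)"
        using Cauchy_Schwarz_ineq[of "P x" "P \<nu>"]
        unfolding uu inner_P_P(1)[of x \<nu>] inner_P_P(1)[of \<nu> \<nu>] .
      then have le: "(P x \<bullet> \<nu>)\<^sup>2 / \<rho> ^ 3 \<le> (P \<nu> \<bullet> \<nu>) / \<rho>"
        using \<rho> by (simp add: divide_simps power2_eq_square power3_eq_cube mult.commute)
      have H\<nu>: "?H x \<nu> \<bullet> \<nu> = (P x \<bullet> \<nu>)\<^sup>2 / \<rho> ^ 3 - (P \<nu> \<bullet> \<nu>) / \<rho>"
        by (simp add: inner_diff_left \<rho>_def power2_eq_square)
      have gx: "(- (1 / norm (P x)) *\<^sub>R P x) \<bullet> x = - \<rho>\<^sup>2 / \<rho>"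
        using uu by (simp add: inner_P[of x x] flip: \<rho>_def)
      have \<theta>: "(P x \<bullet> P x - 2 * real k) / (2 * norm (P x)) = \<rho>\<^sup>2 / \<rho> ^ 3 - (real k + 1) / \<rho> - (- \<rho>\<^sup>2 / \<rho>) / 2"
        unfolding uu \<rho>_def[symmetric] using \<rho> by (simp add: field_simps power2_eq_square power3_eq_cube)
      show ?thesis unfolding tr H\<nu> gx \<theta> using le by simp
    qed
    show "((p - y) \<bullet> - (1 / norm (P p)) *\<^sub>R P p)\<^sup>2 < (norm (p - y))\<^sup>2 * (norm (- (1 / norm (P p)) *\<^sub>R P p))\<^sup>2"
      if "p \<in> C" "y \<in> C" "p \<noteq> y" "dist p y < R" for p y
      using not_radial[OF that] C_P_nonzero[OF k that(1)]
      by (simp add: power_divide divide_simps)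
    show "continuous_on S (\<lambda>x. (P x \<bullet> P x - 2 * real k) / (2 * norm (P x)))"
      using nz by (intro continuous_intros cont_P) auto
    show "0 \<le> (P x \<bullet> P x - 2 * real k) / (2 * norm (P x))" if "x \<in> S" for x
      using outside[OF that] by simp
    show "x \<in> C" if "x \<in> S" "(P x \<bullet> P x - 2 * real k) / (2 * norm (P x)) = 0" for x
      using nz[OF that(1)] that(2) C_iff' by simp
    show "- norm (P x) \<le> - R" if "x \<in> S" for x
      using outside[OF that] by (simp add: norm_eq_sqrt_inner)
    show "inj_on (\<lambda>x. (radial x, - norm (P x))) {x. P x \<noteq> 0}"
      using radial_inj[OF k] by (intro inj_onI) auto
  qed (use S k nz closed_C connected_C C_iff open_P_nonzero cont_radial radial_in_C radial_id
      C_P_nonzero in auto)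
  show ?thesis by (rule S_eq_C)
qed

end

section \<open>Reduction to the hyperplane, inside and outside cases\<close>

theorem theorem1p7:
  fixes \<Sigma> W :: "'a::euclidean_space set" and n k :: nat
  assumes "DIM('a) = n + 1"
    and "shrinker n \<Sigma>"
    and "proper_inclusion \<Sigma>"
    and "intrinsically_complete \<Sigma>"
    and "k \<le> n"
    and "subspace W" and "dim W = k + 1"
    and "on_one_side \<Sigma> (generalized_cylinder k W)"
  shows "\<Sigma> = generalized_cylinder k W"
proof -
  \<comment> \<open>Properness is applied to the compact set formed by a convergent sequence and its
    limit.\<close>
  have "closed \<Sigma>"
    unfolding closed_sequential_limits
  proof (intro allI impI, elim conjE)
    fix x l assume x: "\<forall>n. x n \<in> \<Sigma>" "x \<longlonglongrightarrow> l"
    have "compact (\<Sigma> \<inter> insert l (range x))"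
      using assms(3) compact_sequence_with_limit[OF x(2)] unfolding proper_inclusion_def by blast
    then have "closed (\<Sigma> \<inter> insert l (range x))" by (rule compact_imp_closed)
    then have "l \<in> \<Sigma> \<inter> insert l (range x)"
      by (rule closed_sequentially[OF _ _ x(2)]) (use x(1) in auto)
    then show "l \<in> \<Sigma>" by blast
  qed
  obtain P where "bounded_linear P" "\<And>x. P x \<in> W" "\<And>x. x - P x \<in> orthogonal_comp W"
    "(\<Sum>b\<in>Basis. P b \<bullet> b) = dim W"
    using orthogonal_projection[OF assms(6)] by metis
  then interpret cylinder W k P
    using assms by (intro cylinder.intro) auto
  show ?thesis
  proof (cases "k = 0")
    case True
    then show ?thesis using hyperplane_shrinker_eq assms \<open>closed \<Sigma>\<close> by blast
  next
    case False
    have "(\<forall>x\<in>\<Sigma>. P x \<bullet> P x - 2 * real k \<le> 0) \<or> (\<forall>x\<in>\<Sigma>. 0 \<le> P x \<bullet> P x - 2 * real k)"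
      by (rule on_one_side_cases[OF assms(8)]) (auto intro!: continuous_intros cont_P simp: C_iff')
    then show ?thesis
      using inside_shrinker_eq outside_shrinker_eq False assms(1,2) \<open>closed \<Sigma>\<close>
      by (metis diff_ge_0_iff_ge diff_le_0_iff_le neq0_conv)
  qed
qed

end
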